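(* Let $h_1,h_2,l_1,\alpha_1,\lambda\in\mathbb{C}$ and $t_1,t_2\in\mathbb{C}\setminus\{0\}$. Consider the $q$-difference equation (variant of the singly confluent $q$-hypergeometric equation, type $(1,2)$) $$q^{h_1+h_2-l_1-2\lambda+1/2}t_2(q^{l_1-1/2}t_1-x)g(qx)+(x-q^{h_1+1/2}t_1)(x-q^{h_2+1/2}t_2)g(x/q)$$ $$-\big[q^{\alpha_1}x^2-q^{h_1+h_2-\lambda+1/2}(q^{-h_2}t_1+q^{-h_1}t_2+q^{-l_1}t_2)x+q^{h_1+h_2-\lambda}(q+1)t_1t_2\big]g(x)=0.$$ Each of the following is a formal solution of this equation. (i) $$g(x)=x^{-\alpha_1}\sum_{n=0}^{\infty}(q^{-\lambda-\alpha_1+h_1+1/2}t_1x^{-1})^n(q^{\lambda+\alpha_1};q)_n\sum_{\ell=0}^{n}\frac{(q^{\lambda+\alpha_1-h_1+l_1};q)_\ell}{(q;q)_{n-\ell}(q;q)_\ell}q^{-\ell(2n-\ell-1)/2}(-q^{-\lambda-\alpha_1-l_1+h_2}t_2/t_1)^\ell.$$ (ii) $$g(x)=x^{\lambda}\sum_{n=0}^{\infty}q^n\frac{(q^{\lambda+\alpha_1};q)_n}{(q^{h_1-l_1+1};q)_n(q^{h_2-l_1+1}t_2/t_1;q)_n(q;q)_n}\Big(\frac{x}{q^{l_1-1/2}t_1};q\Big)_n$$ $$\Big(=x^\lambda\,{}_3\phi_2\Big(q^{\lambda+\alpha_1},0,\frac{x}{q^{l_1-1/2}t_1};q^{h_1-l_1+1},q^{h_2-l_1+1}t_2/t_1;q,q\Big)\Big).$$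 (iii) $$g(x)=x^{-\alpha_1}\sum_{n=0}^{\infty}\Big(\frac{q^{h_1+1/2}t_1}{x};q\Big)_n(q^{\lambda+\alpha_1};q)_nq^n\sum_{k=0}^n\frac{q^{k^2}(q^{\lambda+\alpha_1+h_1-h_2}t_1/t_2)^k}{(q^{h_1-l_1+1};q)_k(q;q)_k(q;q)_{n-k}}.$$ (iv) $$g(x)=x^{-\alpha_1}\sum_{n=0}^{\infty}\Big(\frac{q^{h_2+1/2}t_2}{x};q\Big)_n\frac{q^n(q^{\lambda+\alpha_1};q)_n}{(q^{h_2-l_1+1}t_2/t_1;q)_n}\sum_{k=0}^n\frac{(q^{\lambda-h_1+l_1+\alpha_1};q)_k}{(q;q)_k(q;q)_{n-k}}q^{k(k+1)/2}(-q^{h_2-l_1}t_2/t_1)^k.$$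
   Context: Conventions: $q\in\mathbb{C}\setminus\{0\}$ is not a root of unity, with a fixed choice of $\log q$, and $q^{a}=\exp(a\log q)$. $(\lambda;q)_n=\prod_{j=0}^{n-1}(1-\lambda q^j)$. The basic hypergeometric series is ${}_r\phi_s(a_1,\dots,a_r;b_1,\dots,b_s;q,z)=\sum_{n\ge0}\frac{(a_1;q)_n\cdots(a_r;q)_n}{(b_1;q)_n\cdots(b_s;q)_n(q;q)_n}\big[(-1)^nq^{n(n-1)/2}\big]^{1+s-r}z^n$. Parameters are assumed such that no denominator factor in the displayed series vanishes. Formal solutions: convergence is not considered. For $\mu\in\mathbb{C}$, $x^\mu$ is a symbol with $(q^{\pm1}x)^\mu=q^{\pm\mu}x^\mu$. Each series has the form $x^\mu\sum_{n\ge0}a_n\varphi_n(x)$, where $a_n$ does not depend on $x$ and $\varphi_n$ (the $x$-dependent part of the $n$-th term) is a polynomial of degree $n$ in $x$ or a polynomial of degree $n$ in $1/x$ (here $\varphi_n=x^{-n}$ in (i), $(x/(q^{l_1-1/2}t_1);q)_n$ in (ii), $(q^{h_1+1/2}t_1/x;q)_n$ in (iii), $(q^{h_2+1/2}t_2/x;q)_n$ in (iv)). It is a formal solution if, substituting termwise into the left-hand side, dividing by $x^\mu$ (and also by $x^2$ when the $\varphi_n$ are polynomials in $1/x$), and expanding each resulting term in the basis $(\varphi_m)_{m\ge0}$ (in the $1/x$ case, the basis of polynomials in $1/x$), the total coefficient of every $\varphi_m$ (a finite sum) is zero. If the series terminates this means it is an exact solution. *)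

theory Defs
  imports "HOL-Analysis.Analysis" "HOL-Computational_Algebra.Polynomial"
begin

text \<open>Throughout, \<open>lq\<close> is the chosen logarithm of \<open>q\<close>, so that complex powers of \<open>q\<close> are
  \<open>qpow lq a\<close>; the hypothesis \<open>exp lq = q\<close> is made where it is needed.\<close>

definition qpow :: "complex \<Rightarrow> complex \<Rightarrow> complex" where
  "qpow lq a = exp (a * lq)"

definition qpoch :: "complex \<Rightarrow> complex \<Rightarrow> nat \<Rightarrow> complex" where
  "qpoch a q n = (\<Prod>j<n. 1 - a * q ^ j)"

text \<open>The \<open>n\<close>-th term of the basic hypergeometric series with upper parameters \<open>as\<close> and lower
  parameters \<open>bs\<close>. The exponent \<open>1 + s - r\<close> may be negative, hence the integer power.\<close>

definition bhyp_term :: "complex list \<Rightarrow> complex list \<Rightarrow> complex \<Rightarrow> complex \<Rightarrow> nat \<Rightarrow> complex" where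
  "bhyp_term as bs q z n =
     (\<Prod>a\<leftarrow>as. qpoch a q n) / ((\<Prod>b\<leftarrow>bs. qpoch b q n) * qpoch q q n)
     * ((-1) ^ n * q ^ (n * (n - 1) div 2)) powi (1 + int (length bs) - int (length as)) * z ^ n"

text \<open>The left-hand side of the variant of the singly confluent \<open>q\<close>-hypergeometric equation of type
  \<open>(1,2)\<close>, at the point \<open>x\<close>, with \<open>gp\<close>, \<open>gm\<close>, \<open>g\<close> in the places of
  \<open>g(q x)\<close>, \<open>g(x / q)\<close>, \<open>g(x)\<close>.\<close>

definition sc_variant_lhs ::
  "complex \<Rightarrow> complex \<Rightarrow> complex \<Rightarrow> complex \<Rightarrow> complex \<Rightarrow> complex \<Rightarrow> complex \<Rightarrow> complex \<Rightarrow> complex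
   \<Rightarrow> complex \<Rightarrow> complex \<Rightarrow> complex \<Rightarrow> complex \<Rightarrow> complex" where
  "sc_variant_lhs lq q h1 h2 l1 \<alpha>1 lam t1 t2 x gp gm g =
     qpow lq (h1 + h2 - l1 - 2 * lam + 1/2) * t2 * (qpow lq (l1 - 1/2) * t1 - x) * gp
     + (x - qpow lq (h1 + 1/2) * t1) * (x - qpow lq (h2 + 1/2) * t2) * gm
     - (qpow lq \<alpha>1 * x\<^sup>2
        - qpow lq (h1 + h2 - lam + 1/2)
            * (qpow lq (- h2) * t1 + qpow lq (- h1) * t2 + qpow lq (- l1) * t2) * x
        + qpow lq (h1 + h2 - lam) * (q + 1) * t1 * t2) * g"

text \<open>\<open>\<phi> n\<close> is a polynomial of degree exactly \<open>n\<close> in \<open>u x\<close>, where \<open>u x\<close> will be \<open>x\<close> or \<open>1/x\<close>.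
  The condition \<open>p \<noteq> 0\<close> matters for \<open>n = 0\<close> only, as \<open>degree 0 = 0\<close>.\<close>

definition poly_basis :: "(complex \<Rightarrow> complex) \<Rightarrow> (nat \<Rightarrow> complex \<Rightarrow> complex) \<Rightarrow> bool" where
  "poly_basis u \<phi> \<longleftrightarrow> (\<forall>n. \<exists>p. p \<noteq> 0 \<and> degree p = n \<and> (\<forall>x. x \<noteq> 0 \<longrightarrow> \<phi> n x = poly p (u x)))"

text \<open>The series \<open>x\<^sup>\<mu> \<Sum>n. a n * \<phi> n x\<close> as a formal solution of \<open>E x (g (q x)) (g (x / q)) (g x) = 0\<close>
  for an \<open>E\<close> linear in its last three arguments. The symbol \<open>x\<^sup>\<mu>\<close> is divided out, and leaves the
  factors \<open>q\<^sup>\<mu>\<close> at \<open>q x\<close> and \<open>q\<^sup>-\<^sup>\<mu>\<close> at \<open>x / q\<close>. The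
  \<open>c n m\<close> are the coefficients, with respect to the basis \<open>\<phi>\<close>, of what \<open>E\<close> makes of \<open>x\<^sup>\<mu> * \<phi> n x\<close>
  (divided by \<open>x ^ d\<close>); they are unique by \<open>poly_basis\<close>.\<close>

definition formal_solution_in ::
  "(complex \<Rightarrow> complex) \<Rightarrow> nat \<Rightarrow> complex \<Rightarrow> complex
   \<Rightarrow> (complex \<Rightarrow> complex \<Rightarrow> complex \<Rightarrow> complex \<Rightarrow> complex)
   \<Rightarrow> complex \<Rightarrow> (nat \<Rightarrow> complex) \<Rightarrow> (nat \<Rightarrow> complex \<Rightarrow> complex) \<Rightarrow> bool" where
  "formal_solution_in u d lq q E \<mu> a \<phi> \<longleftrightarrow>
     poly_basis u \<phi> \<and>
     (\<exists>c :: nat \<Rightarrow> nat \<Rightarrow> complex.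
        (\<forall>n. finite {m. c n m \<noteq> 0} \<and>
             (\<forall>x. x \<noteq> 0 \<longrightarrow>
                E x (qpow lq \<mu> * \<phi> n (q * x)) (qpow lq (- \<mu>) * \<phi> n (x / q)) (\<phi> n x) / x ^ d
                = (\<Sum>m | c n m \<noteq> 0. c n m * \<phi> m x))) \<and>
        (\<forall>m. finite {n. c n m \<noteq> 0} \<and> (\<Sum>n | c n m \<noteq> 0. a n * c n m) = 0))"

text \<open>Which disjunct applies is determined by \<open>\<phi>\<close>, as a polynomial of degree 1 in \<open>x\<close> is not a
  polynomial in \<open>1/x\<close>.\<close>

definition formal_solution ::
  "complex \<Rightarrow> complex \<Rightarrow> (complex \<Rightarrow> complex \<Rightarrow> complex \<Rightarrow> complex \<Rightarrow> complex)
   \<Rightarrow> complex \<Rightarrow> (nat \<Rightarrow> complex) \<Rightarrow> (nat \<Rightarrow> complex \<Rightarrow> complex) \<Rightarrow> bool" where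
  "formal_solution lq q E \<mu> a \<phi> \<longleftrightarrow>
     formal_solution_in (\<lambda>x. x) 0 lq q E \<mu> a \<phi> \<or> formal_solution_in (\<lambda>x. 1 / x) 2 lq q E \<mu> a \<phi>"

text \<open>A terminating formal solution is an exact solution: any function \<open>w\<close> that transforms like
  \<open>x\<^sup>\<mu>\<close> may be put in the place of the symbol.\<close>

lemma sc_variant_lhs_sum:
  assumes "finite N"
  shows "sc_variant_lhs lq q h1 h2 l1 \<alpha>1 lam t1 t2 x
           (r * (\<Sum>n\<in>N. a n * u n)) (r * (\<Sum>n\<in>N. a n * v n)) (r * (\<Sum>n\<in>N. a n * w n))
         = r * (\<Sum>n\<in>N. a n * sc_variant_lhs lq q h1 h2 l1 \<alpha>1 lam t1 t2 x (u n) (v n) (w n))"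
  using assms
  by (induction N rule: finite_induct) (simp_all add: sc_variant_lhs_def algebra_simps)

lemma formal_solution_in_terminating:
  fixes lq q h1 h2 l1 \<alpha>1 lam t1 t2
  defines "E \<equiv> sc_variant_lhs lq q h1 h2 l1 \<alpha>1 lam t1 t2"
  assumes sol: "formal_solution_in u d lq q E \<mu> a \<phi>"
    and fin: "finite {n. a n \<noteq> 0}"
    and x: "x \<noteq> 0"
  shows "(\<Sum>n | a n \<noteq> 0. a n *
            E x (qpow lq \<mu> * \<phi> n (q * x)) (qpow lq (- \<mu>) * \<phi> n (x / q)) (\<phi> n x)) = 0"
proof -
  let ?T = "\<lambda>n. E x (qpow lq \<mu> * \<phi> n (q * x)) (qpow lq (- \<mu>) * \<phi> n (x / q)) (\<phi> n x)"
  let ?N = "{n. a n \<noteq> 0}"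
  obtain c :: "nat \<Rightarrow> nat \<Rightarrow> complex" where
    c1: "\<And>n. finite {m. c n m \<noteq> 0}"
    and c2: "\<And>n. ?T n / x ^ d = (\<Sum>m | c n m \<noteq> 0. c n m * \<phi> m x)"
    and c3: "\<And>m. finite {n. c n m \<noteq> 0}" "\<And>m. (\<Sum>n | c n m \<noteq> 0. a n * c n m) = 0"
    using sol x unfolding formal_solution_in_def by blast
  define M where "M = (\<Union>n\<in>?N. {m. c n m \<noteq> 0})"
  have M: "finite M" using fin c1 by (auto simp: M_def)
  have T: "?T n = x ^ d * (\<Sum>m\<in>M. c n m * \<phi> m x)" if "n \<in> ?N" for n
  proof -
    have "(\<Sum>m | c n m \<noteq> 0. c n m * \<phi> m x) = (\<Sum>m\<in>M. c n m * \<phi> m x)"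
      using that M by (intro sum.mono_neutral_left) (auto simp: M_def)
    then show ?thesis using c2[of n] x by (simp add: field_simps)
  qed
  have Z: "(\<Sum>n\<in>?N. a n * c n m) = 0" for m
  proof -
    have "(\<Sum>n\<in>?N. a n * c n m) = (\<Sum>n | c n m \<noteq> 0. a n * c n m)"
      using fin c3(1)[of m] by (intro sum.mono_neutral_cong) auto
    then show ?thesis using c3(2) by simp
  qed
  have "(\<Sum>n\<in>?N. a n * ?T n) = (\<Sum>n\<in>?N. \<Sum>m\<in>M. x ^ d * \<phi> m x * (a n * c n m))"
    by (rule sum.cong[OF refl], subst T) (auto simp: sum_distrib_left algebra_simps)
  also have "\<dots> = (\<Sum>m\<in>M. x ^ d * \<phi> m x * (\<Sum>n\<in>?N. a n * c n m))"
    by (subst sum.swap) (simp add: sum_distrib_left)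
  also have "\<dots> = 0" by (simp add: Z)
  finally show ?thesis .
qed

lemma formal_solution_terminating:
  fixes lq q h1 h2 l1 \<alpha>1 lam t1 t2 a \<phi> w
  defines "E \<equiv> sc_variant_lhs lq q h1 h2 l1 \<alpha>1 lam t1 t2"
    and "g \<equiv> \<lambda>x. w x * (\<Sum>n | a n \<noteq> 0. a n * \<phi> n x)"
  assumes sol: "formal_solution lq q E \<mu> a \<phi>"
    and fin: "finite {n. a n \<noteq> 0}"
    and w: "w (q * x) = qpow lq \<mu> * w x" "w (x / q) = qpow lq (- \<mu>) * w x"
    and x: "x \<noteq> 0"
  shows "E x (g (q * x)) (g (x / q)) (g x) = 0"
proof -
  have 0: "(\<Sum>n | a n \<noteq> 0. a n *
            E x (qpow lq \<mu> * \<phi> n (q * x)) (qpow lq (- \<mu>) * \<phi> n (x / q)) (\<phi> n x)) = 0"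
    using sol formal_solution_in_terminating[OF _ fin x] unfolding formal_solution_def E_def by blast
  have g: "g (q * x) = w x * (\<Sum>n | a n \<noteq> 0. a n * (qpow lq \<mu> * \<phi> n (q * x)))"
    "g (x / q) = w x * (\<Sum>n | a n \<noteq> 0. a n * (qpow lq (- \<mu>) * \<phi> n (x / q)))"
    "g x = w x * (\<Sum>n | a n \<noteq> 0. a n * \<phi> n x)"
    by (simp_all add: g_def w sum_distrib_left algebra_simps)
  show ?thesis
    unfolding g using sc_variant_lhs_sum[OF fin] 0 by (simp add: E_def)
qed

end

theory Submission
  imports Defs
begin

text \<open>Put \<open>P = q\<^bsup>h1+1/2\<^esup> t1\<close>, \<open>Q = q\<^bsup>h2+1/2\<^esup> t2\<close>, \<open>R = q\<^bsup>h1+h2-l1+1/2\<^esup> t2\<close>. In these parameters the equation is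
  symmetric in \<open>P\<close> and \<open>Q\<close>. On each of the bases the operator is a band matrix with entries in
  positions \<open>n - 1, \<dots>, n + 2\<close>, so a formal solution is a sequence satisfying a four-term recurrence.
  For (ii) the recurrence splits into multiples of the first-order recurrence of the
  coefficients. For (i) and (iii) the coefficients contain a sum over \<open>k\<close>, and the recurrence follows
  by creative telescoping in \<open>k\<close>. Solution (iv) is (iii) with \<open>P\<close> and \<open>Q\<close> exchanged: the
  two inner sums agree by the \<open>q\<close>-binomial theorem.\<close>

section \<open>Shifted factorials and the polynomial bases built from them\<close>

lemma qpoch_0 [simp]: "qpoch a q 0 = 1"
  by (simp add: qpoch_def)

lemma qpoch_Suc: "qpoch a q (Suc n) = qpoch a q n * (1 - a * q ^ n)"
  by (simp add: qpoch_def)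

lemma qpoch_Suc': "qpoch a q (Suc n) = (1 - a) * qpoch (a * q) q n"
  by (simp add: qpoch_def prod.lessThan_Suc_shift mult_ac del: prod.lessThan_Suc)

lemma qpoch_add: "qpoch a q (m + n) = qpoch a q m * qpoch (a * q ^ m) q n"
  by (induction n) (simp_all add: qpoch_Suc power_add mult_ac)

lemma qpoch_zero_base [simp]: "qpoch 0 q n = 1"
  by (simp add: qpoch_def)

lemma qpoch_div_q_Suc: "q \<noteq> 0 \<Longrightarrow> qpoch (a / q) q (Suc n) = (1 - a / q) * qpoch a q n"
  by (simp add: qpoch_Suc')

lemma poly_basis_monomials: "poly_basis u (\<lambda>n x. u x ^ n)"
  unfolding poly_basis_def
  by (intro allI exI[of _ "monom 1 n" for n]) (auto simp: degree_monom_eq poly_monom)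

lemma poly_basis_qpoch:
  assumes "q \<noteq> 0" "\<kappa> \<noteq> 0"
  shows "poly_basis u (\<lambda>n x. qpoch (\<kappa> * u x) q n)"
  unfolding poly_basis_def
proof
  fix n
  let ?p = "\<Prod>j<n. [:1, - \<kappa> * q ^ j:]"
  have "degree ?p = (\<Sum>j<n. degree [:1, - \<kappa> * q ^ j:])"
    using assms by (intro degree_prod_eq_sum_degree) auto
  then have "degree ?p = n" using assms by simp
  moreover have "?p \<noteq> 0" by (simp add: prod_zero_iff)
  moreover have "qpoch (\<kappa> * u x) q n = poly ?p (u x)" for x
    by (simp add: qpoch_def poly_prod mult_ac)
  ultimately show "\<exists>p. p \<noteq> 0 \<and> degree p = n \<and> (\<forall>x. x \<noteq> 0 \<longrightarrow> qpoch (\<kappa> * u x) q n = poly p (u x))"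
    by blast
qed

section \<open>Band matrices and telescoping sums\<close>

text \<open>Row \<open>n\<close> of the matrix of the operator is supported on
  \<open>n - 1, ..., n + 2\<close>, so column \<open>m\<close> meets only the rows
  \<open>m - 2, ..., m + 1\<close>. Columns 0 and 1 lack some of these rows; hence
  \<open>rec0\<close> and \<open>rec1\<close> stand beside \<open>rec2\<close>.\<close>

lemma formal_solution_in_bandI:
  fixes b p r s :: "nat \<Rightarrow> complex"
  assumes basis: "poly_basis u \<phi>"
    and expand: "\<And>n x. x \<noteq> 0 \<Longrightarrow>
      E x (qpow lq \<mu> * \<phi> n (q * x)) (qpow lq (- \<mu>) * \<phi> n (x / q)) (\<phi> n x) / x ^ d
      = b n * \<phi> (n - 1) x + p n * \<phi> n x + r n * \<phi> (n + 1) x + s n * \<phi> (n + 2) x"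
    and b0: "b 0 = 0"
    and rec0: "a 1 * b 1 + a 0 * p 0 = 0"
    and rec1: "a 2 * b 2 + a 1 * p 1 + a 0 * r 0 = 0"
    and rec2: "\<And>m. a (m + 3) * b (m + 3) + a (m + 2) * p (m + 2)
      + a (m + 1) * r (m + 1) + a m * s m = 0"
  shows "formal_solution_in u d lq q E \<mu> a \<phi>"
proof -
  define c where "c n m = (if m = n + 2 then s n else if m = n + 1 then r n
    else if m = n then p n else if m + 1 = n then b n else 0)" for n m
  have supp: "{m. c n m \<noteq> 0} \<subseteq> {n - 1..n + 2}" for n
    by (auto simp: c_def split: if_splits)
  have supp': "{n. c n m \<noteq> 0} \<subseteq> {m - 2..m + 1}" for m
    by (auto simp: c_def split: if_splits)
  have row: "(\<Sum>m | c n m \<noteq> 0. c n m * \<phi> m x)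
      = b n * \<phi> (n - 1) x + p n * \<phi> n x + r n * \<phi> (n + 1) x + s n * \<phi> (n + 2) x" for n x
  proof -
    have "(\<Sum>m | c n m \<noteq> 0. c n m * \<phi> m x) = (\<Sum>m = n - 1..n + 2. c n m * \<phi> m x)"
      using supp by (intro sum.mono_neutral_left) auto
    also have "\<dots> = b n * \<phi> (n - 1) x + p n * \<phi> n x + r n * \<phi> (n + 1) x + s n * \<phi> (n + 2) x"
    proof (cases n)
      case 0
      \<comment> \<open>Truncated subtraction makes \<open>\<phi> (0 - 1)\<close> equal to
        \<open>\<phi> 0\<close>; \<open>b 0 = 0\<close> removes this spurious term.\<close>
      have "{0 - 1..0 + 2} = {0, 1, 2 :: nat}" by auto
      then show ?thesis using b0 by (simp add: 0 c_def numeral_2_eq_2)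
    next
      case (Suc k)
      have "{Suc k - 1..Suc k + 2} = {k, k + 1, k + 2, k + 3}" by auto
      then show ?thesis by (simp add: Suc c_def numeral_3_eq_3)
    qed
    finally show ?thesis .
  qed
  have col: "(\<Sum>n | c n m \<noteq> 0. a n * c n m) = 0" for m
  proof -
    have "(\<Sum>n | c n m \<noteq> 0. a n * c n m) = (\<Sum>n = m - 2..m + 1. a n * c n m)"
      using supp' by (intro sum.mono_neutral_left) auto
    also have "\<dots> = 0"
    proof -
      consider "m = 0" | "m = 1" | k where "m = k + 2"
        by (metis One_nat_def add_2_eq_Suc' not0_implies_Suc)
      then show ?thesis
      proof cases
        case 1
        have "{0 - 2..0 + 1} = {0, 1 :: nat}" by auto
        then show ?thesis using rec0 by (simp add: 1 c_def add_ac)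
      next
        case 2
        have "{1 - 2..1 + 1} = {0, 1, 2 :: nat}" by auto
        then show ?thesis using rec1 by (simp add: 2 c_def add_ac)
      next
        case 3
        have "{k + 2 - 2..k + 2 + 1} = {k, k + 1, k + 2, k + 3}" by auto
        then show ?thesis using rec2[of k] by (simp add: 3 c_def add_ac numeral_3_eq_3)
      qed
    qed
    finally show ?thesis .
  qed
  show ?thesis
    unfolding formal_solution_in_def
    using basis row col expand finite_subset[OF supp] finite_subset[OF supp']
    by (intro conjI exI[of _ c]) auto
qed

text \<open>The form in which creative telescoping is applied: \<open>V k\<close> and
  \<open>U k\<close> are the values at \<open>k\<close> and \<open>k + 1\<close> of one certificate.
  Matching is demanded only for \<open>k < n\<close>, where \<open>n - Suc k\<close> is a true
  difference. The boundary conditions will hold because each \<open>V\<close> contains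
  \<open>1 - q ^ k\<close> and each \<open>U\<close> contains a factor that vanishes at the last
  index.\<close>

lemma sum_telescope_zero:
  fixes U V :: "nat \<Rightarrow> 'a :: ab_group_add"
  assumes "\<And>k. k < n \<Longrightarrow> U k = V (Suc k)" "V 0 = 0" "U n = 0"
  shows "(\<Sum>k\<le>n. U k - V k) = 0"
proof -
  have "(\<Sum>k\<le>n. U k) = (\<Sum>k<n. V (Suc k))"
    using assms by (simp flip: lessThan_Suc_atMost)
  moreover have "(\<Sum>k\<le>n. V k) = V 0 + (\<Sum>k<n. V (Suc k))"
    unfolding lessThan_Suc_atMost[symmetric] by (rule sum.lessThan_Suc_shift)
  ultimately show ?thesis
    using assms by (simp add: sum_subtractf)
qed

text \<open>The operator of the equation, with \<open>A = q\<^bsup>\<alpha>1\<^esup>\<close> and \<open>L = q\<^bsup>\<lambda>\<^esup>\<close>.\<close>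

definition confl_op where
  "confl_op q P Q R A L x gp gm g =
     (P * Q / q - R * x) / L\<^sup>2 * gp + (x - P) * (x - Q) * gm
     - (A * x\<^sup>2 - (P + Q + R) / L * x + P * Q * (q + 1) / (q * L)) * (g :: complex)"

lemma confl_op_commute: "confl_op q P Q R A L = confl_op q Q P R A L"
  by (simp add: confl_op_def fun_eq_iff algebra_simps)

section \<open>Finite sums with \<open>qpoch q q (n - k)\<close> in the denominator\<close>

locale non_root_of_unity =
  fixes q :: complex
  assumes q_nz: "q \<noteq> 0" and not_root: "\<And>n. n > 0 \<Longrightarrow> q ^ n \<noteq> 1"
begin

lemma qpoch_q_nz [simp]: "qpoch q q n \<noteq> 0"
proof -
  have "q * q ^ j \<noteq> 1" for j using not_root[of "Suc j"] by simp
  then show ?thesis by (auto simp: qpoch_def)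
qed

lemma one_minus_nz: "1 - q * q ^ n \<noteq> 0"
  using not_root[of "Suc n"] by simp

text \<open>Each factor of the product lowers the index of \<open>qpoch q q (n - k)\<close> by one,
  and as soon as \<open>k + j > n\<close> one factor is zero. Thus sums belonging to
  \<open>n\<close>, \<open>n - 1\<close>, \<open>n - 2\<close>, ... are written over one range with
  a common summand, and a recurrence in \<open>n\<close> can be checked summand by summand.\<close>

lemma qconv_shift:
  "(\<Sum>k\<le>n. g k / qpoch q q (n - k) * (\<Prod>i<j. 1 - q ^ n / q ^ (k + i)))
   = (if j \<le> n then \<Sum>k\<le>n - j. g k / qpoch q q (n - j - k) else 0)"
proof -
  have summand: "(\<Prod>i<j. 1 - q ^ n / q ^ (k + i)) / qpoch q q (n - k)
      = (if k + j \<le> n then 1 / qpoch q q (n - j - k) else 0)" if "k \<le> n" for k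
  proof (induction j)
    case 0
    then show ?case using that by simp
  next
    case (Suc j)
    have split: "(\<Prod>i<Suc j. 1 - q ^ n / q ^ (k + i)) / qpoch q q (n - k)
        = (\<Prod>i<j. 1 - q ^ n / q ^ (k + i)) / qpoch q q (n - k) * (1 - q ^ n / q ^ (k + j))"
      by simp
    consider "k + Suc j \<le> n" | "k + j = n" | "k + j > n" by linarith
    then show ?case
    proof cases
      case 1
      then obtain i where n: "n = k + Suc j + i" using le_Suc_ex by blast
      have "1 - q ^ n / q ^ (k + j) = 1 - q * q ^ i"
        using q_nz by (simp add: n power_add)
      moreover have "n - j - k = Suc i" "n - Suc j - k = i" "k + j \<le> n" using n by auto
      ultimately show ?thesis
        unfolding split Suc.IH using 1 one_minus_nz[of i] by (simp add: qpoch_Suc)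
    next
      case 2
      then have "1 - q ^ n / q ^ (k + j) = 0" using q_nz by simp
      then show ?thesis unfolding split using 2 by simp
    next
      case 3
      then show ?thesis unfolding split Suc.IH by simp
    qed
  qed
  have "(\<Sum>k\<le>n. g k / qpoch q q (n - k) * (\<Prod>i<j. 1 - q ^ n / q ^ (k + i)))
      = (\<Sum>k\<le>n. if k + j \<le> n then g k / qpoch q q (n - j - k) else 0)"
  proof (rule sum.cong[OF refl])
    fix k assume "k \<in> {..n}"
    then show "g k / qpoch q q (n - k) * (\<Prod>i<j. 1 - q ^ n / q ^ (k + i))
        = (if k + j \<le> n then g k / qpoch q q (n - j - k) else 0)"
      using arg_cong[OF summand[of k], of "(*) (g k)"] by (cases "k + j \<le> n") simp_all
  qed
  also have "\<dots> = (\<Sum>k \<in> {k. k \<le> n \<and> k + j \<le> n}. g k / qpoch q q (n - j - k))"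
    by (simp add: sum.If_cases Int_def)
  also have "{k. k \<le> n \<and> k + j \<le> n} = (if j \<le> n then {..n - j} else {})"
    by auto
  finally show ?thesis by (simp split: if_splits)
qed

lemma qpoch_diff: "k < n \<Longrightarrow> qpoch q q (n - k) = qpoch q q (n - Suc k) * (1 - q ^ n / q ^ k)"
proof -
  assume "k < n"
  then obtain i where n: "n = Suc (k + i)" using less_imp_Suc_add by blast
  then have "q ^ n / q ^ k = q * q ^ i" using q_nz by (simp add: power_add)
  then show ?thesis by (simp add: n qpoch_Suc)
qed

lemma one_minus_div_nz: "k < n \<Longrightarrow> 1 - q ^ n / q ^ k \<noteq> 0"
  using qpoch_diff[of k n] by (metis mult_zero_right qpoch_q_nz)

text \<open>In the induction step telescoping shows that passing from \<open>n\<close> to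
  \<open>n + 1\<close> multiplies the sum by \<open>(1 - a * q ^ n) / (1 - q * q ^ n)\<close>, as it
  does the quotient on the right.\<close>

lemma q_binomial_theorem:
  "(\<Sum>k\<le>n. (- a) ^ k * q ^ (k choose 2) / (qpoch q q k * qpoch q q (n - k)))
   = qpoch a q n / qpoch q q n"
proof (induction n)
  case 0
  then show ?case by (simp add: numeral_2_eq_2)
next
  case (Suc n)
  define g where "g k = (- a) ^ k * q ^ (k choose 2) / qpoch q q k" for k
  define f where "f k = g k / qpoch q q (Suc n - k)" for k
  \<comment> \<open>The summand of the wanted recurrence is sorted by powers of \<open>a\<close>:
    the part free of \<open>a\<close> is \<open>- V k\<close>, the part linear in \<open>a\<close>
    is \<open>U k\<close>. The ratio \<open>f (Suc k) / f k\<close> carries exactly one factor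
    \<open>a\<close>, which makes \<open>V (Suc k)\<close> equal to \<open>U k\<close>.\<close>
  define V where "V k = - (q * q ^ n / q ^ k * (1 - q ^ k) * f k)" for k
  define U where "U k = a * q ^ n * (1 - q * q ^ n / q ^ k) * f k" for k
  have "(\<Sum>k\<le>Suc n. U k - V k) = 0"
  proof (rule sum_telescope_zero)
    fix k assume k: "k < Suc n"
    define D where "D = 1 - q ^ Suc n / q ^ k"
    have D: "D \<noteq> 0" "qpoch q q (Suc n - k) = qpoch q q (Suc n - Suc k) * D"
      unfolding D_def by (rule one_minus_div_nz[OF k], rule qpoch_diff[OF k])
    have "f (Suc k) = - a * q ^ k * D / (1 - q * q ^ k) * f k"
      unfolding f_def D(2) g_def using D(1)
      by (simp add: qpoch_Suc numeral_2_eq_2 power_add mult_ac)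
    then have "V (Suc k) = a * q ^ n * D * f k"
      unfolding V_def using one_minus_nz[of k] q_nz by simp
    then show "U k = V (Suc k)" by (simp add: U_def D_def)
  qed (use q_nz in \<open>simp_all add: U_def V_def\<close>)
  moreover have "U k - V k = (1 - q * q ^ n) * f k
      - (1 - a * q ^ n) * (f k * (1 - q ^ Suc n / q ^ k))" for k
    using q_nz by (simp add: U_def V_def field_simps)
  ultimately have "(1 - q * q ^ n) * (\<Sum>k\<le>Suc n. f k)
      = (1 - a * q ^ n) * (\<Sum>k\<le>Suc n. f k * (1 - q ^ Suc n / q ^ k))"
    by (simp only: sum_subtractf sum_distrib_left[symmetric]) simp
  also have "(\<Sum>k\<le>Suc n. f k * (1 - q ^ Suc n / q ^ k)) = (\<Sum>k\<le>n. g k / qpoch q q (n - k))"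
    using qconv_shift[of g "Suc n" 1] by (simp add: f_def)
  also have "\<dots> = qpoch a q n / qpoch q q n"
    using Suc.IH by (simp add: g_def)
  finally have "(\<Sum>k\<le>Suc n. f k) = (1 - a * q ^ n) * (qpoch a q n / qpoch q q n) / (1 - q * q ^ n)"
    using one_minus_nz[of n] by (simp add: eq_divide_eq mult_ac del: sum.atMost_Suc)
  then show ?case
    by (simp add: f_def g_def qpoch_Suc mult_ac del: sum.atMost_Suc)
qed

lemma choose_two_add: "(i + j) choose 2 = (i choose 2) + (j choose 2) + i * j"
  by (induction i) (simp_all add: numeral_2_eq_2)

lemma square_eq_choose_two: "(n :: nat)\<^sup>2 = 2 * (n choose 2) + n"
  by (induction n) (simp_all add: numeral_2_eq_2)

text \<open>On the right \<open>(c; q)_k / (q; q)_k\<close> is expanded by the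
  \<open>q\<close>-binomial theorem and the double sum is reordered. The inner sum is then again a
  \<open>q\<close>-binomial sum, now with \<open>b * q ^ j\<close> in place of
  \<open>a\<close>.\<close>

lemma sum_transform:
  assumes b: "\<And>n. qpoch b q n \<noteq> 0"
  shows "(\<Sum>k\<le>n. q ^ (k\<^sup>2) * (c * b / q) ^ k / (qpoch b q k * qpoch q q k * qpoch q q (n - k)))
    = (\<Sum>k\<le>n. qpoch c q k / (qpoch q q k * qpoch q q (n - k)) * q ^ (k choose 2) * (- b) ^ k)
      / qpoch b q n"
proof -
  \<comment> \<open>The summand for \<open>k = j + i\<close>, where \<open>j\<close> is the index of
    the expansion of \<open>(c; q)_k / (q; q)_k\<close>.\<close>
  define h where "h j i = (- c) ^ j * q ^ (j choose 2) / (qpoch q q j * qpoch q q i)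
    * q ^ ((j + i) choose 2) * (- b) ^ (j + i) / qpoch q q (n - (j + i))" for j i
  have "(\<Sum>k\<le>n. qpoch c q k / (qpoch q q k * qpoch q q (n - k)) * q ^ (k choose 2) * (- b) ^ k)
      = (\<Sum>k\<le>n. \<Sum>j\<le>k. h j (k - j))"
  proof (rule sum.cong[OF refl])
    fix k
    have "qpoch c q k / (qpoch q q k * qpoch q q (n - k)) * q ^ (k choose 2) * (- b) ^ k
        = (qpoch c q k / qpoch q q k) * (q ^ (k choose 2) * (- b) ^ k / qpoch q q (n - k))"
      by simp
    also have "\<dots> = (\<Sum>j\<le>k. h j (k - j))"
      unfolding q_binomial_theorem[symmetric] sum_distrib_right
      by (rule sum.cong) (simp_all add: h_def)
    finally show "qpoch c q k / (qpoch q q k * qpoch q q (n - k)) * q ^ (k choose 2) * (- b) ^ k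
        = (\<Sum>j\<le>k. h j (k - j))" .
  qed
  also have "\<dots> = (\<Sum>(j, i) \<in> {(j, i). j + i \<le> n}. h j i)"
    by (rule sum.triangle_reindex_eq[symmetric])
  also have "{(j, i). j + i \<le> n} = (SIGMA j:{..n}. {..n - j})"
    by auto
  also have "(\<Sum>(j, i) \<in> (SIGMA j:{..n}. {..n - j}). h j i) = (\<Sum>j\<le>n. \<Sum>i\<le>n - j. h j i)"
    by (rule sum.Sigma[symmetric]) auto
  also have "\<dots> = (\<Sum>j\<le>n. q ^ (j\<^sup>2) * (c * b / q) ^ j
      / (qpoch b q j * qpoch q q j * qpoch q q (n - j)) * qpoch b q n)"
  proof (rule sum.cong[OF refl])
    fix j assume "j \<in> {..n}"
    then have j: "j \<le> n" by simp
    \<comment> \<open>One \<open>q ^ (j choose 2)\<close> comes from the expansion, the other from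
      splitting \<open>(j + i) choose 2\<close>; the extra \<open>q ^ j\<close> cancels the
      denominator of \<open>(c * b / q) ^ j\<close>.\<close>
    have sq: "q ^ (j\<^sup>2) = q ^ (j choose 2) * q ^ (j choose 2) * q ^ j"
      by (simp add: square_eq_choose_two mult_2 power_add)
    have "(\<Sum>i\<le>n - j. h j i) = (\<Sum>i\<le>n - j. (c * b) ^ j * q ^ (j choose 2) * q ^ (j choose 2) / qpoch q q j
        * ((- (b * q ^ j)) ^ i * q ^ (i choose 2) / (qpoch q q i * qpoch q q (n - j - i))))"
    proof (rule sum.cong[OF refl])
      fix i
      have c: "(c * b) ^ j = (- c) ^ j * (- b) ^ j"
        by (simp flip: power_mult_distrib)
      have b: "(- (b * q ^ j)) ^ i = (- b) ^ i * q ^ (j * i)"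
        unfolding mult_minus_left[symmetric] power_mult_distrib power_mult by (rule refl)
      have d: "n - j - i = n - (j + i)" by simp
      show "h j i = (c * b) ^ j * q ^ (j choose 2) * q ^ (j choose 2) / qpoch q q j
        * ((- (b * q ^ j)) ^ i * q ^ (i choose 2) / (qpoch q q i * qpoch q q (n - j - i)))"
        unfolding h_def choose_two_add power_add b c d by (simp add: mult_ac)
    qed
    also have "\<dots> = (c * b) ^ j * q ^ (j choose 2) * q ^ (j choose 2) / qpoch q q j
        * (qpoch (b * q ^ j) q (n - j) / qpoch q q (n - j))"
      by (simp only: sum_distrib_left[symmetric] q_binomial_theorem)
    also have "qpoch (b * q ^ j) q (n - j) = qpoch b q n / qpoch b q j"
      using qpoch_add[of b q j "n - j"] j b[of j] by simp
    finally show "(\<Sum>i\<le>n - j. h j i) = q ^ (j\<^sup>2) * (c * b / q) ^ j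
      / (qpoch b q j * qpoch q q j * qpoch q q (n - j)) * qpoch b q n"
      using q_nz by (simp add: sq power_divide mult_ac)
  qed
  also have "\<dots> = (\<Sum>k\<le>n. q ^ (k\<^sup>2) * (c * b / q) ^ k
      / (qpoch b q k * qpoch q q k * qpoch q q (n - k))) * qpoch b q n"
    by (simp only: sum_distrib_right)
  finally show ?thesis using b[of n] by simp
qed

section \<open>Solution (iii): the basis of shifted factorials in \<open>1 / x\<close>\<close>

text \<open>The band entries for the basis \<open>(w; q)\<^sub>n\<close>, \<open>w = P / x\<close>, as functions of \<open>Z = q ^ n\<close>; here
  \<open>\<rho> = Q / P\<close>, \<open>\<sigma> = R / P\<close> and \<open>B = q\<^bsup>\<lambda>+\<alpha>1\<^esup>\<close>. The factors \<open>1 - B Z\<close> and \<open>1 - B q Z\<close> of the two upper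
  entries, which make the series terminate if \<open>B q ^ n = 1\<close>, are split off.\<close>

definition coef_m where
  "coef_m \<rho> \<sigma> Z = (1 - 1 / Z) * (\<rho> * q / Z\<^sup>2 - \<sigma> * q / Z)"

definition coef_0 where
  "coef_0 \<rho> \<sigma> B Z = \<rho> / q * (1 / Z ^ 3 - (1 - 1 / Z) * (q * (q + 1) / Z\<^sup>2))
     - \<sigma> * (1 / Z\<^sup>2 - (1 - 1 / Z) * q / Z)
     - B\<^sup>2 + B * (1 + \<rho> + \<sigma>) / Z - B * \<rho> * (1 + 1 / q) / Z\<^sup>2"

definition coef_1 where
  "coef_1 \<rho> \<sigma> B Z = (\<rho> + \<sigma>) / Z\<^sup>2 - \<rho> * (1 + 1 / q + 1 / q\<^sup>2) / Z ^ 3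
     + B * (\<rho> / (q * Z\<^sup>2) - 1 / Z)"

definition coef_2 where
  "coef_2 \<rho> Z = \<rho> / (q\<^sup>2 * Z ^ 3)"

text \<open>The substitution of \<open>q * x\<close> for \<open>x\<close> is that of
  \<open>w / q\<close> for \<open>w\<close>. The choice \<open>w = P / x\<close> puts
  \<open>1 - w\<close> in front of \<open>qpoch (q * w) q n\<close>, and together they form
  \<open>qpoch w q (n + 1)\<close>. For \<open>n > 0\<close> every term is then a multiple of
  \<open>qpoch w q (n - 1)\<close>, and an identity of cubic polynomials in \<open>w\<close>
  remains. For \<open>n = 0\<close> the lower entry vanishes because \<open>coef_m\<close> contains
  \<open>1 - 1 / Z\<close>.\<close>

lemma op_qpoch_expand:
  fixes w \<rho> \<sigma> B :: complex
  shows "(\<rho> / q * w\<^sup>2 - \<sigma> * w) * qpoch (w / q) q n + B\<^sup>2 * ((1 - w) * (1 - \<rho> * w) * qpoch (q * w) q n)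
      - (B\<^sup>2 - B * (1 + \<rho> + \<sigma>) * w + B * \<rho> * (q + 1) / q * w\<^sup>2) * qpoch w q n
    = coef_m \<rho> \<sigma> (q ^ n) * qpoch w q (n - 1) + coef_0 \<rho> \<sigma> B (q ^ n) * qpoch w q n
    + (1 - B * q ^ n) * coef_1 \<rho> \<sigma> B (q ^ n) * qpoch w q (n + 1)
    + (1 - B * q ^ n) * (1 - B * (q * q ^ n)) * coef_2 \<rho> (q ^ n) * qpoch w q (n + 2)"
proof -
  have e: "(1 - w) * (1 - \<rho> * w) * qpoch (q * w) q n = (1 - \<rho> * w) * qpoch w q (Suc n)"
    by (simp add: qpoch_Suc' mult_ac)
  show ?thesis
  proof (cases n)
    case 0
    show ?thesis using q_nz unfolding e coef_m_def coef_0_def coef_1_def coef_2_def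
      by (simp add: 0 qpoch_Suc numeral_2_eq_2) (simp add: field_simps)
  next
    case (Suc k)
    define Z where "Z = q ^ k"
    define F where "F = qpoch w q k"
    have Z: "Z \<noteq> 0" using q_nz by (simp add: Z_def)
    have "qpoch (w / q) q (Suc k) = (1 - w / q) * F"
      unfolding F_def by (rule qpoch_div_q_Suc[OF q_nz])
    then have F0: "qpoch (w / q) q n = (1 - w / q) * F" by (simp only: Suc)
    have F: "qpoch w q n = F * (1 - w * Z)"
      "qpoch w q (Suc n) = F * (1 - w * Z) * (1 - w * (q * Z))"
      "qpoch w q (n + 2) = F * (1 - w * Z) * (1 - w * (q * Z)) * (1 - w * (q * (q * Z)))"
      "qpoch w q (n - 1) = F" "q ^ n = q * Z"
      using q_nz by (simp_all add: Suc F_def Z_def qpoch_Suc numeral_2_eq_2)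
    show ?thesis using q_nz Z unfolding e coef_m_def coef_0_def coef_1_def coef_2_def Suc_eq_plus1[symmetric] F F0
      by (simp add: field_simps) algebra
  qed
qed

text \<open>By \<open>qconv_shift\<close> the four sums are those for \<open>n\<close>,
  \<open>n - 1\<close>, \<open>n - 2\<close>, \<open>n - 3\<close>, read as 0 at negative indices,
  so the shorter relations of columns 0 and 1 are instances too. The powers of \<open>q\<close> in
  front and the factor \<open>1 - B * q ^ n / q\<close> are what the prefactor
  \<open>(B; q)_n * q ^ n\<close> of the coefficients contributes.\<close>

lemma square_exponent_sum_recurrence:
  fixes \<rho> \<sigma> B :: complex
  assumes \<rho>: "\<rho> \<noteq> 0" and b: "\<And>n. qpoch (q * \<sigma> / \<rho>) q n \<noteq> 0"
  defines "f \<equiv> \<lambda>n k. q ^ (k\<^sup>2) * (B / \<rho>) ^ k / (qpoch (q * \<sigma> / \<rho>) q k * qpoch q q k) / qpoch q q (n - k)"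
  shows "(1 - B * q ^ n / q) * q ^ 3 * coef_m \<rho> \<sigma> (q ^ n) * (\<Sum>k\<le>n. f n k)
    + q\<^sup>2 * coef_0 \<rho> \<sigma> B (q ^ n / q) * (\<Sum>k\<le>n. f n k * (\<Prod>i<1. 1 - q ^ n / q ^ (k + i)))
    + q * coef_1 \<rho> \<sigma> B (q ^ n / q\<^sup>2) * (\<Sum>k\<le>n. f n k * (\<Prod>i<2. 1 - q ^ n / q ^ (k + i)))
    + coef_2 \<rho> (q ^ n / q ^ 3) * (\<Sum>k\<le>n. f n k * (\<Prod>i<3. 1 - q ^ n / q ^ (k + i))) = 0"
proof -
  define M where "M = q ^ n"
  have M: "M \<noteq> 0" using q_nz by (simp add: M_def)
  \<comment> \<open>The certificate: the denominators of \<open>f n (Suc k) / f n k\<close> force the factors \<open>1 - q ^ k\<close> and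
    \<open>1 - \<sigma> / \<rho> * q ^ k\<close>; the linear factor comes from comparing coefficients of powers of \<open>q ^ k\<close>.\<close>
  define V where "V k = \<rho> * q ^ 3 / (q ^ k) ^ 3 * (q - B * q ^ k) * (1 - q ^ k)
    * (1 - \<sigma> / \<rho> * q ^ k) * f n k" for k
  \<comment> \<open>This is \<open>V (Suc k)\<close> as a multiple of \<open>f n k\<close>: the
    ratio \<open>f n (Suc k) / f n k\<close> cancels the two factors provided in \<open>V\<close>
    and brings in \<open>1 - M / q ^ k\<close>.\<close>
  define U where "U k = B * q\<^sup>2 * (1 - B * q ^ k) * (1 - M / q ^ k) / q ^ k * f n k" for k
  have "(\<Sum>k\<le>n. U k - V k) = 0"
  proof (rule sum_telescope_zero)
    fix k assume k: "k < n"
    define X where "X = q ^ k"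
    define D where "D = 1 - M / X"
    have D: "D \<noteq> 0" "qpoch q q (n - k) = qpoch q q (n - Suc k) * D"
      unfolding D_def M_def X_def by (rule one_minus_div_nz[OF k], rule qpoch_diff[OF k])
    have X: "X \<noteq> 0" "1 - q * X \<noteq> 0"
      using q_nz one_minus_nz[of k] by (simp_all add: X_def)
    define b where "b = q * \<sigma> / \<rho>"
    have bX: "1 - b * X \<noteq> 0"
      using assms(2)[of "Suc k"] unfolding qpoch_Suc X_def b_def by simp
    have sq: "q ^ ((Suc k)\<^sup>2) = q ^ (k\<^sup>2) * (X * X) * q"
      by (simp add: X_def power2_eq_square power_add)
    have f: "f n (Suc k) = q * X\<^sup>2 * (B / \<rho>) * D / ((1 - b * X) * (1 - q * X)) * f n k"
      unfolding f_def D(2) sq qpoch_Suc b_def[symmetric] X_def[symmetric] power_Suc using D(1)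
      by (simp add: power2_eq_square mult_ac)
    have "V (Suc k) = \<rho> * q ^ 3 / (q * X) ^ 3 * (q - B * (q * X)) * (1 - q * X) * (1 - b * X) * f n (Suc k)"
      by (simp add: V_def X_def b_def mult_ac)
    also have "\<dots> = B * q\<^sup>2 * (1 - B * X) * D / X * f n k"
      unfolding f using X bX q_nz \<rho>
      by (simp add: divide_simps) (simp add: algebra_simps power2_eq_square power3_eq_cube)
    finally show "U k = V (Suc k)" by (simp add: U_def D_def X_def)
  qed (use q_nz in \<open>simp_all add: U_def V_def M_def\<close>)
  moreover have "U k - V k = (1 - B * M / q) * q ^ 3 * coef_m \<rho> \<sigma> M * f n k
    + q\<^sup>2 * coef_0 \<rho> \<sigma> B (M / q) * (f n k * (\<Prod>i<1. 1 - M / q ^ (k + i)))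
    + q * coef_1 \<rho> \<sigma> B (M / q\<^sup>2) * (f n k * (\<Prod>i<2. 1 - M / q ^ (k + i)))
    + coef_2 \<rho> (M / q ^ 3) * (f n k * (\<Prod>i<3. 1 - M / q ^ (k + i)))" for k
  proof -
    define X where "X = q ^ k"
    define F where "F = f n k"
    have X: "X \<noteq> 0" using q_nz by (simp add: X_def)
    have p: "(\<Prod>i<1. 1 - M / q ^ (k + i)) = 1 - M / X"
      "(\<Prod>i<2. 1 - M / q ^ (k + i)) = (1 - M / X) * (1 - M / (q * X))"
      "(\<Prod>i<3. 1 - M / q ^ (k + i)) = (1 - M / X) * (1 - M / (q * X)) * (1 - M / (q * (q * X)))"
      by (simp_all add: X_def numeral_2_eq_2 numeral_3_eq_3)
    \<comment> \<open>With the common summand \<open>F\<close> removed, this is an identity of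
      rational functions in which \<open>X = q ^ k\<close> and \<open>M = q ^ n\<close> are
      independent variables.\<close>
    have "B * q\<^sup>2 * (1 - B * X) * (1 - M / X) / X - \<rho> * q ^ 3 / X ^ 3 * (q - B * X) * (1 - X) * (1 - \<sigma> / \<rho> * X)
      = (1 - B * M / q) * q ^ 3 * coef_m \<rho> \<sigma> M + q\<^sup>2 * coef_0 \<rho> \<sigma> B (M / q) * (1 - M / X)
      + q * coef_1 \<rho> \<sigma> B (M / q\<^sup>2) * ((1 - M / X) * (1 - M / (q * X)))
      + coef_2 \<rho> (M / q ^ 3) * ((1 - M / X) * (1 - M / (q * X)) * (1 - M / (q * (q * X))))"
      unfolding coef_m_def coef_0_def coef_1_def coef_2_def
      using q_nz X M \<rho> by (simp add: field_simps) algebra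
    from arg_cong[OF this, of "\<lambda>z. z * F"] show ?thesis
      unfolding U_def V_def p X_def[symmetric] F_def[symmetric]
      by (simp only: ring_distribs mult_ac)
  qed
  ultimately show ?thesis
    unfolding M_def[symmetric] by (simp only: sum.distrib sum_distrib_left[symmetric])
qed

lemma formal_solution_in_confl_op_qpoch_inverse:
  assumes nz: "P \<noteq> 0" "Q \<noteq> 0" "A \<noteq> 0" "L \<noteq> 0"
    and \<mu>: "qpow lq \<mu> = 1 / A" "qpow lq (- \<mu>) = A"
    and b: "\<And>n. qpoch (q * R / Q) q n \<noteq> 0"
  shows "formal_solution_in (\<lambda>x. 1 / x) 2 lq q (confl_op q P Q R A L) \<mu>
    (\<lambda>n. qpoch (L * A) q n * q ^ n * (\<Sum>k\<le>n. q ^ (k\<^sup>2) * (L * A * P / Q) ^ k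
      / (qpoch (q * R / Q) q k * qpoch q q k * qpoch q q (n - k))))
    (\<lambda>n x. qpoch (P / x) q n)"
proof -
  \<comment> \<open>After division by \<open>x\<^sup>2\<close> and by the constant \<open>K\<close>,
    the operator in the variable \<open>w = P / x\<close> depends on the ratios
    \<open>\<rho>\<close>, \<open>\<sigma>\<close> and on the product \<open>B\<close> only.\<close>
  define \<rho> \<sigma> B K where "\<rho> = Q / P" and "\<sigma> = R / P" and "B = L * A" and "K = 1 / (L\<^sup>2 * A)"
  define S where "S n = (\<Sum>k\<le>n. q ^ (k\<^sup>2) * (B / \<rho>) ^ k
    / (qpoch (q * \<sigma> / \<rho>) q k * qpoch q q k) / qpoch q q (n - k))" for n
  have par: "\<rho> \<noteq> 0" "q * \<sigma> / \<rho> = q * R / Q" "B / \<rho> = L * A * P / Q"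
    using nz by (simp_all add: \<rho>_def \<sigma>_def B_def)
  have b': "qpoch (q * \<sigma> / \<rho>) q n \<noteq> 0" for n
    unfolding par using b .
  note rec = square_exponent_sum_recurrence[OF par(1) b', of B, unfolded qconv_shift, folded S_def]
  define a where "a n = qpoch B q n * q ^ n * S n" for n
  have "formal_solution_in (\<lambda>x. 1 / x) 2 lq q (confl_op q P Q R A L) \<mu> a (\<lambda>n x. qpoch (P / x) q n)"
  proof (rule formal_solution_in_bandI[where b = "\<lambda>n. K * coef_m \<rho> \<sigma> (q ^ n)"
        and p = "\<lambda>n. K * coef_0 \<rho> \<sigma> B (q ^ n)"
        and r = "\<lambda>n. K * ((1 - B * q ^ n) * coef_1 \<rho> \<sigma> B (q ^ n))"
        and s = "\<lambda>n. K * ((1 - B * q ^ n) * (1 - B * (q * q ^ n)) * coef_2 \<rho> (q ^ n))"])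
    show "poly_basis (\<lambda>x. 1 / x) (\<lambda>n x. qpoch (P / x) q n)"
      using poly_basis_qpoch[OF q_nz nz(1), of "\<lambda>x. 1 / x"] by simp
  next
    fix n and x :: complex
    assume x: "x \<noteq> 0"
    define w where "w = P / x"
    define F1 F2 F3 where "F1 = qpoch (w / q) q n" and "F2 = qpoch (q * w) q n" and "F3 = qpoch w q n"
    have w: "w \<noteq> 0" "x = P / w" using nz x by (simp_all add: w_def)
    have "P / (q * x) = w / q" "P / (x / q) = q * w" by (simp_all add: w_def)
    then have "confl_op q P Q R A L x (qpow lq \<mu> * qpoch (P / (q * x)) q n)
        (qpow lq (- \<mu>) * qpoch (P / (x / q)) q n) (qpoch (P / x) q n) / x\<^sup>2
      = confl_op q P Q R A L x (F1 / A) (A * F2) F3 / x\<^sup>2"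
      by (simp add: \<mu> F1_def F2_def F3_def w_def[symmetric])
    also have "\<dots> = K * ((\<rho> / q * w\<^sup>2 - \<sigma> * w) * F1 + B\<^sup>2 * ((1 - w) * (1 - \<rho> * w) * F2)
      - (B\<^sup>2 - B * (1 + \<rho> + \<sigma>) * w + B * \<rho> * (q + 1) / q * w\<^sup>2) * F3)"
      unfolding w(2) confl_op_def K_def B_def \<rho>_def \<sigma>_def
      using w(1) nz q_nz by (simp add: field_simps power2_eq_square)
    also note op_qpoch_expand[of \<rho> w \<sigma> n B, folded F1_def F2_def F3_def]
    finally show "confl_op q P Q R A L x (qpow lq \<mu> * qpoch (P / (q * x)) q n)
        (qpow lq (- \<mu>) * qpoch (P / (x / q)) q n) (qpoch (P / x) q n) / x\<^sup>2
      = K * coef_m \<rho> \<sigma> (q ^ n) * qpoch (P / x) q (n - 1)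
      + K * coef_0 \<rho> \<sigma> B (q ^ n) * qpoch (P / x) q n
      + K * ((1 - B * q ^ n) * coef_1 \<rho> \<sigma> B (q ^ n)) * qpoch (P / x) q (n + 1)
      + K * ((1 - B * q ^ n) * (1 - B * (q * q ^ n)) * coef_2 \<rho> (q ^ n)) * qpoch (P / x) q (n + 2)"
      unfolding w_def F3_def by (simp only: distrib_left mult.assoc)
  next
    show "K * coef_m \<rho> \<sigma> (q ^ 0) = 0" by (simp add: coef_m_def)
  next
    \<comment> \<open>At \<open>n = 1\<close> the case distinction of \<open>qconv_shift\<close>
      drops the last two sums; what is left is column 0 up to a constant factor.\<close>
    have "(1 - B) * q ^ 3 * coef_m \<rho> \<sigma> q * S 1 + q\<^sup>2 * coef_0 \<rho> \<sigma> B 1 * S 0 = 0"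
      using rec[of 1] q_nz by simp
    then have "K / q\<^sup>2 * ((1 - B) * q ^ 3 * coef_m \<rho> \<sigma> q * S 1 + q\<^sup>2 * coef_0 \<rho> \<sigma> B 1 * S 0) = 0"
      by simp
    then show "a 1 * (K * coef_m \<rho> \<sigma> (q ^ 1)) + a 0 * (K * coef_0 \<rho> \<sigma> B (q ^ 0)) = 0"
      using q_nz by (simp add: a_def qpoch_Suc distrib_left power2_eq_square power3_eq_cube mult_ac)
  next
    have "(1 - B * q) * q ^ 3 * coef_m \<rho> \<sigma> (q\<^sup>2) * S 2 + q\<^sup>2 * coef_0 \<rho> \<sigma> B q * S 1
        + q * coef_1 \<rho> \<sigma> B 1 * S 0 = 0"
      using rec[of 2] q_nz by (simp add: power2_eq_square)
    then have "K / q * (1 - B) * ((1 - B * q) * q ^ 3 * coef_m \<rho> \<sigma> (q\<^sup>2) * S 2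
        + q\<^sup>2 * coef_0 \<rho> \<sigma> B q * S 1 + q * coef_1 \<rho> \<sigma> B 1 * S 0) = 0"
      by simp
    then show "a 2 * (K * coef_m \<rho> \<sigma> (q\<^sup>2)) + a 1 * (K * coef_0 \<rho> \<sigma> B (q ^ 1))
        + a 0 * (K * ((1 - B * q ^ 0) * coef_1 \<rho> \<sigma> B (q ^ 0))) = 0"
      using q_nz
      by (simp add: a_def qpoch_Suc numeral_2_eq_2 distrib_left power2_eq_square power3_eq_cube mult_ac)
  next
    fix m
    define Z where "Z = q ^ m"
    have Z: "q ^ (m + 3) = q ^ 3 * Z" "q ^ (m + 2) = q\<^sup>2 * Z" "q ^ (m + 1) = q * Z"
      by (simp_all add: Z_def power_add power2_eq_square power3_eq_cube)
    \<comment> \<open>\<open>C\<close> contains \<open>qpoch B q (m + 2)\<close>, the factor common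
      to all four terms: where \<open>a (m + 1)\<close> and \<open>a m\<close> fall short of it, the
      factors split off from the upper band entries complete it. Nothing is divided by
      \<open>1 - B * q ^ n\<close>, so terminating series are covered.\<close>
    define C where "C = qpoch B q m * (1 - B * Z) * (1 - B * (q * Z))"
    have qp: "qpoch B q (m + 3) = qpoch B q (m + 2) * (1 - B * q ^ (m + 2))"
      "qpoch B q (m + 2) = qpoch B q (m + 1) * (1 - B * q ^ (m + 1))"
      "qpoch B q (m + 1) = qpoch B q m * (1 - B * q ^ m)"
      by (simp_all add: numeral_3_eq_3 qpoch_Suc)
    have a: "a (m + 3) = C * (1 - B * (q\<^sup>2 * Z)) * (q ^ 3 * Z) * S (m + 3)"
      "a (m + 2) = C * (q\<^sup>2 * Z) * S (m + 2)"
      "a (m + 1) * (1 - B * (q * Z)) = C * (q * Z) * S (m + 1)"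
      "a m * ((1 - B * Z) * (1 - B * (q * Z))) = C * Z * S m"
      unfolding a_def C_def qp Z Z_def[symmetric] by (simp_all add: mult_ac)
    have "(1 - B * (q\<^sup>2 * Z)) * q ^ 3 * coef_m \<rho> \<sigma> (q ^ 3 * Z) * S (m + 3)
        + q\<^sup>2 * coef_0 \<rho> \<sigma> B (q\<^sup>2 * Z) * S (m + 2)
        + q * coef_1 \<rho> \<sigma> B (q * Z) * S (m + 1) + coef_2 \<rho> Z * S m = 0"
      using rec[of "m + 3", unfolded Z] q_nz
      by (simp add: power2_eq_square power3_eq_cube mult_ac)
    then have "K * C * Z * ((1 - B * (q\<^sup>2 * Z)) * q ^ 3 * coef_m \<rho> \<sigma> (q ^ 3 * Z) * S (m + 3)
        + q\<^sup>2 * coef_0 \<rho> \<sigma> B (q\<^sup>2 * Z) * S (m + 2)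
        + q * coef_1 \<rho> \<sigma> B (q * Z) * S (m + 1) + coef_2 \<rho> Z * S m) = 0"
      by (simp only: mult_zero_right)
    moreover have "a (m + 3) * (K * coef_m \<rho> \<sigma> (q ^ 3 * Z))
        + a (m + 2) * (K * coef_0 \<rho> \<sigma> B (q\<^sup>2 * Z))
        + a (m + 1) * (1 - B * (q * Z)) * (K * coef_1 \<rho> \<sigma> B (q * Z))
        + a m * ((1 - B * Z) * (1 - B * (q * Z))) * (K * coef_2 \<rho> Z)
      = K * C * Z * ((1 - B * (q\<^sup>2 * Z)) * q ^ 3 * coef_m \<rho> \<sigma> (q ^ 3 * Z) * S (m + 3)
        + q\<^sup>2 * coef_0 \<rho> \<sigma> B (q\<^sup>2 * Z) * S (m + 2)
        + q * coef_1 \<rho> \<sigma> B (q * Z) * S (m + 1) + coef_2 \<rho> Z * S m)"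
      unfolding a by (simp only: distrib_left mult_ac)
    ultimately show "a (m + 3) * (K * coef_m \<rho> \<sigma> (q ^ (m + 3)))
        + a (m + 2) * (K * coef_0 \<rho> \<sigma> B (q ^ (m + 2)))
        + a (m + 1) * (K * ((1 - B * q ^ (m + 1)) * coef_1 \<rho> \<sigma> B (q ^ (m + 1))))
        + a m * (K * ((1 - B * q ^ m) * (1 - B * (q * q ^ m)) * coef_2 \<rho> (q ^ m))) = 0"
      unfolding Z Z_def[symmetric] by (simp only: mult_ac)
  qed
  then show ?thesis
    unfolding a_def S_def par unfolding B_def by (simp add: mult_ac)
qed

section \<open>Solution (ii): the basis of shifted factorials in \<open>x\<close>\<close>

text \<open>With \<open>T\<close> the shift of the basis index by one, the four entries are the
  coefficients of \<open>(C / T + W) * (1 - T) * (1 - T / q)\<close>. This factorization is what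
  reduces the four-term recurrence to a first-order one. As
  \<open>(1 - z) * qpoch (q * z) q n\<close> is \<open>qpoch z q (n + 1)\<close>, the check is again
  a polynomial identity in \<open>z\<close>.\<close>

lemma op_qpoch_expand_direct:
  fixes z g g' B :: complex
  defines "W \<equiv> \<lambda>Z. g * g' * (1 - B * Z) / Z ^ 3"
    and "C \<equiv> \<lambda>Z. (1 - 1 / Z) * (1 - g * q / Z) * (1 - g' * q / Z)"
  shows "(1 - z) * qpoch (q * z) q n / q + (1 - g * z) * (1 - g' * z) * qpoch (z / q) q n
      - (B * g * g' * z\<^sup>2 - (g + g' + 1 / q) * z + (q + 1) / q) * qpoch z q n
    = C (q ^ n) * qpoch z q (n - 1) + (W (q ^ n) - (1 + 1 / q) * C (q ^ n)) * qpoch z q n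
    + (C (q ^ n) / q - (1 + 1 / q) * W (q ^ n)) * qpoch z q (n + 1)
    + W (q ^ n) / q * qpoch z q (n + 2)"
proof -
  have e: "(1 - z) * qpoch (q * z) q n = qpoch z q (Suc n)"
    by (simp add: qpoch_Suc' mult_ac)
  show ?thesis
  proof (cases n)
    case 0
    show ?thesis using q_nz unfolding e W_def C_def
      by (simp add: 0 qpoch_Suc numeral_2_eq_2) (simp add: field_simps)
  next
    case (Suc k)
    define Z where "Z = q ^ k"
    define F where "F = qpoch z q k"
    have Z: "Z \<noteq> 0" using q_nz by (simp add: Z_def)
    have "qpoch (z / q) q (Suc k) = (1 - z / q) * F"
      unfolding F_def by (rule qpoch_div_q_Suc[OF q_nz])
    then have F0: "qpoch (z / q) q n = (1 - z / q) * F" by (simp only: Suc)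
    have F: "qpoch z q n = F * (1 - z * Z)"
      "qpoch z q (Suc n) = F * (1 - z * Z) * (1 - z * (q * Z))"
      "qpoch z q (n + 2) = F * (1 - z * Z) * (1 - z * (q * Z)) * (1 - z * (q * (q * Z)))"
      "qpoch z q (n - 1) = F" "q ^ n = q * Z"
      using q_nz by (simp_all add: Suc F_def Z_def qpoch_Suc numeral_2_eq_2)
    show ?thesis using q_nz Z unfolding e W_def C_def Suc_eq_plus1[symmetric] F F0
      by (simp add: field_simps) algebra
  qed
qed

lemma formal_solution_in_confl_op_qpoch:
  assumes nz: "P \<noteq> 0" "Q \<noteq> 0" "R \<noteq> 0" "A \<noteq> 0" "L \<noteq> 0"
    and \<mu>: "qpow lq \<mu> = L" "qpow lq (- \<mu>) = 1 / L"
    and b: "\<And>n. qpoch (q * R / Q) q n \<noteq> 0" and b': "\<And>n. qpoch (q * R / P) q n \<noteq> 0"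
  shows "formal_solution_in (\<lambda>x. x) 0 lq q (confl_op q P Q R A L) \<mu>
    (\<lambda>n. q ^ n * (qpoch (L * A) q n
      / (qpoch (q * R / Q) q n * qpoch (q * R / P) q n * qpoch q q n)))
    (\<lambda>n x. qpoch (q * R / (P * Q) * x) q n)"
proof -
  \<comment> \<open>The scale \<open>\<kappa>\<close> moves the root of the coefficient of
    \<open>g(q x)\<close> to \<open>z = 1\<close>; the numbers \<open>g\<close> and
    \<open>g'\<close> are the reciprocals of the lower parameters.\<close>
  define g g' B K \<kappa> where "g = Q / (q * R)" and "g' = P / (q * R)" and "B = L * A"
    and "K = P * Q / L" and "\<kappa> = q * R / (P * Q)"
  have g: "g \<noteq> 0" "g' \<noteq> 0" "q * R / Q = 1 / g" "q * R / P = 1 / g'"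
    using nz q_nz by (simp_all add: g_def g'_def)
  have \<kappa>: "\<kappa> \<noteq> 0" using nz q_nz by (simp add: \<kappa>_def)
  define W where "W n = g * g' * (1 - B * q ^ n) / (q ^ n) ^ 3" for n
  define C where "C n = (1 - 1 / q ^ n) * (1 - g * q / q ^ n) * (1 - g' * q / q ^ n)" for n
  define a where "a n = q ^ n * (qpoch B q n / (qpoch (1 / g) q n * qpoch (1 / g') q n * qpoch q q n))" for n
  \<comment> \<open>The first-order recurrence: the two-term factor \<open>C / T + W\<close>
    annihilates the coefficient sequence.\<close>
  have step: "a (Suc n) * C (Suc n) = - (a n * W n)" for n
  proof -
    define Z where "Z = q ^ n"
    have "1 - 1 / g * Z \<noteq> 0" "1 - 1 / g' * Z \<noteq> 0"
      using b[of "Suc n"] b'[of "Suc n"] unfolding qpoch_Suc g Z_def by simp_all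
    then have ne: "g - Z \<noteq> 0" "g' - Z \<noteq> 0" "1 - q * Z \<noteq> 0" "Z \<noteq> 0"
      using g one_minus_nz[of n] q_nz by (auto simp: Z_def)
    have "a (Suc n) = a n * (q * (1 - B * Z) / ((1 - 1 / g * Z) * (1 - 1 / g' * Z) * (1 - q * Z)))"
      by (simp add: a_def qpoch_Suc Z_def mult_ac)
    also have "q * (1 - B * Z) / ((1 - 1 / g * Z) * (1 - 1 / g' * Z) * (1 - q * Z))
      = q * (1 - B * Z) * (g * g') / ((g - Z) * (g' - Z) * (1 - q * Z))"
      using ne g by (simp add: divide_simps)
    finally have s: "a (Suc n) = a n * (q * (1 - B * Z) * (g * g') / ((g - Z) * (g' - Z) * (1 - q * Z)))" .
    have c: "C (Suc n) = - ((g - Z) * (g' - Z) * (1 - q * Z)) / (q * Z ^ 3)"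
      unfolding C_def power_Suc Z_def[symmetric] using ne q_nz
      by (simp add: field_simps power3_eq_cube)
    show ?thesis
      unfolding s c W_def Z_def[symmetric] using ne q_nz by simp
  qed
  have "formal_solution_in (\<lambda>x. x) 0 lq q (confl_op q P Q R A L) \<mu> a (\<lambda>n x. qpoch (\<kappa> * x) q n)"
  proof (rule formal_solution_in_bandI[where b = "\<lambda>n. K * C n"
        and p = "\<lambda>n. K * (W n - (1 + 1 / q) * C n)"
        and r = "\<lambda>n. K * (C n / q - (1 + 1 / q) * W n)"
        and s = "\<lambda>n. K * (W n / q)"])
    show "poly_basis (\<lambda>x. x) (\<lambda>n x. qpoch (\<kappa> * x) q n)"
      by (rule poly_basis_qpoch[OF q_nz \<kappa>])
  next
    fix n and x :: complex
    assume x: "x \<noteq> 0"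
    define z where "z = \<kappa> * x"
    define F1 F2 F3 where "F1 = qpoch (q * z) q n" and "F2 = qpoch (z / q) q n" and "F3 = qpoch z q n"
    have z: "x = P * Q / (q * R) * z" using nz q_nz by (simp add: z_def \<kappa>_def)
    have args: "\<kappa> * (q * x) = q * z" "\<kappa> * (x / q) = z / q" by (simp_all add: z_def)
    have "confl_op q P Q R A L x (qpow lq \<mu> * qpoch (\<kappa> * (q * x)) q n)
        (qpow lq (- \<mu>) * qpoch (\<kappa> * (x / q)) q n) (qpoch (\<kappa> * x) q n) / x ^ 0
      = confl_op q P Q R A L x (L * F1) (F2 / L) F3"
      unfolding args \<mu> F1_def F2_def F3_def z_def[symmetric] by simp
    also have "\<dots> = K * ((1 - z) * F1 / q + (1 - g * z) * (1 - g' * z) * F2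
      - (B * g * g' * z\<^sup>2 - (g + g' + 1 / q) * z + (q + 1) / q) * F3)"
      unfolding z confl_op_def K_def B_def g_def g'_def
      using nz q_nz by (simp add: field_simps power2_eq_square)
    also note op_qpoch_expand_direct[of z n g g' B, folded F1_def F2_def F3_def, folded W_def C_def]
    finally show "confl_op q P Q R A L x (qpow lq \<mu> * qpoch (\<kappa> * (q * x)) q n)
        (qpow lq (- \<mu>) * qpoch (\<kappa> * (x / q)) q n) (qpoch (\<kappa> * x) q n) / x ^ 0
      = K * C n * qpoch (\<kappa> * x) q (n - 1) + K * (W n - (1 + 1 / q) * C n) * qpoch (\<kappa> * x) q n
      + K * (C n / q - (1 + 1 / q) * W n) * qpoch (\<kappa> * x) q (n + 1)
      + K * (W n / q) * qpoch (\<kappa> * x) q (n + 2)"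
      unfolding z_def F3_def by (simp only: distrib_left mult.assoc)
  next
    show C0: "K * C 0 = 0" by (simp add: C_def)
    show "a 1 * (K * C 1) + a 0 * (K * (W 0 - (1 + 1 / q) * C 0)) = 0"
    proof -
      \<comment> \<open>\<open>C 0 = 0\<close> takes the place of the first-order relation at index
        -1.\<close>
      have "a 1 * C 1 = - (a 0 * W 0)" "C 0 = 0"
        using step[of 0] by (simp_all add: C_def[of 0])
      then show ?thesis by algebra
    qed
    show "a 2 * (K * C 2) + a 1 * (K * (W 1 - (1 + 1 / q) * C 1))
        + a 0 * (K * (C 0 / q - (1 + 1 / q) * W 0)) = 0"
    proof -
      have "a 2 * C 2 = - (a 1 * W 1)" "a 1 * C 1 = - (a 0 * W 0)" "C 0 = 0"
        using step[of 0] step[of 1] by (simp_all add: numeral_2_eq_2 C_def[of 0])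
      then show ?thesis by algebra
    qed
    fix m
    \<comment> \<open>The column is the combination of these three relations with weights
      \<open>1\<close>, \<open>- (1 + 1 / q)\<close> and \<open>1 / q\<close>.\<close>
    have "a (m + 3) * C (m + 3) = - (a (m + 2) * W (m + 2))"
      "a (m + 2) * C (m + 2) = - (a (m + 1) * W (m + 1))"
      "a (m + 1) * C (m + 1) = - (a m * W m)"
      using step[of m] step[of "m + 1"] step[of "m + 2"] by (simp_all add: numeral_2_eq_2 numeral_3_eq_3)
    then show "a (m + 3) * (K * C (m + 3)) + a (m + 2) * (K * (W (m + 2) - (1 + 1 / q) * C (m + 2)))
        + a (m + 1) * (K * (C (m + 1) / q - (1 + 1 / q) * W (m + 1))) + a m * (K * (W m / q)) = 0"
      unfolding divide_inverse by algebra
  qed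
  then show ?thesis
    unfolding a_def B_def \<kappa>_def g .
qed

section \<open>Solution (i): powers of \<open>1 / x\<close>\<close>

text \<open>Here the summand depends on \<open>n\<close> also through \<open>(q ^ k) ^ n\<close>.
  The factors \<open>q ^ k\<close> and \<open>(q ^ k)\<^sup>2\<close> correct this, so that the
  products again produce the sums for \<open>n - 1\<close> and \<open>n - 2\<close>.\<close>

lemma inverse_power_sum_recurrence:
  fixes \<rho> \<sigma> B c e :: complex
  assumes ec: "B * e = - \<sigma>" "\<sigma> * c = B * \<rho>"
  defines "g \<equiv> \<lambda>k. qpoch c q k / qpoch q q k * q ^ (Suc k choose 2) * e ^ k"
  defines "f \<equiv> \<lambda>n k. g k / (q ^ k) ^ n / qpoch q q (n - k)"
  shows "B * (q ^ n - 1) * (\<Sum>k\<le>n. f n k)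
    + (B * (1 + \<rho>) - \<sigma> * q / q ^ n) * (\<Sum>k\<le>n. f n k * q ^ k * (\<Prod>i<1. 1 - q ^ n / q ^ (k + i)))
    + B * \<rho> * q / q ^ n * (\<Sum>k\<le>n. f n k * (q ^ k)\<^sup>2 * (\<Prod>i<2. 1 - q ^ n / q ^ (k + i))) = 0"
proof -
  define M where "M = q ^ n"
  have M: "M \<noteq> 0" using q_nz by (simp add: M_def)
  \<comment> \<open>The factor \<open>1 - q ^ k\<close> absorbs the denominator
    \<open>1 - q * q ^ k\<close> of \<open>f n (Suc k) / f n k\<close>; \<open>U k\<close> is the
    resulting \<open>V (Suc k)\<close> with \<open>B * e\<close> replaced by
    \<open>- \<sigma>\<close>.\<close>
  define V where "V k = B * (1 - q ^ k) * f n k" for k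
  define U where "U k = - (\<sigma> * (1 - c * q ^ k) * (1 - M / q ^ k) * q ^ k * q / M * f n k)" for k
  have "(\<Sum>k\<le>n. U k - V k) = 0"
  proof (rule sum_telescope_zero)
    fix k assume k: "k < n"
    define X where "X = q ^ k"
    define D where "D = 1 - M / X"
    have D: "D \<noteq> 0" "qpoch q q (n - k) = qpoch q q (n - Suc k) * D"
      unfolding D_def M_def X_def by (rule one_minus_div_nz[OF k], rule qpoch_diff[OF k])
    have X: "X \<noteq> 0" "1 - q * X \<noteq> 0"
      using q_nz one_minus_nz[of k] by (simp_all add: X_def)
    have pw: "q ^ (Suc (Suc k) choose 2) = q ^ (Suc k choose 2) * (q * X)" "(q * X) ^ n = M * X ^ n"
      by (simp_all add: X_def M_def numeral_2_eq_2 power_add power_mult_distrib)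
    have f: "f n (Suc k) = (1 - c * X) * (q * X) * e * D / ((1 - q * X) * M) * f n k"
      unfolding f_def g_def D(2) pw(1) qpoch_Suc power_Suc X_def[symmetric] pw(2) using D(1)
      by (simp add: mult_ac)
    have "V (Suc k) = B * (1 - q * X) * f n (Suc k)"
      by (simp add: V_def X_def)
    also have "\<dots> = (B * e) * ((1 - c * X) * D * X * q / M * f n k)"
      unfolding f using X(2) by (simp add: mult_ac)
    also have "\<dots> = U k"
      unfolding ec U_def D_def X_def by simp
    finally show "U k = V (Suc k)" ..
  qed (use q_nz in \<open>simp_all add: U_def V_def M_def\<close>)
  moreover have "U k - V k = B * (M - 1) * f n k
    + (B * (1 + \<rho>) - \<sigma> * q / M) * (f n k * q ^ k * (\<Prod>i<1. 1 - M / q ^ (k + i)))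
    + B * \<rho> * q / M * (f n k * (q ^ k)\<^sup>2 * (\<Prod>i<2. 1 - M / q ^ (k + i)))" for k
  proof -
    define X where "X = q ^ k"
    define F where "F = f n k"
    have X: "X \<noteq> 0" using q_nz by (simp add: X_def)
    have p: "(\<Prod>i<1. 1 - M / q ^ (k + i)) = 1 - M / X"
      "(\<Prod>i<2. 1 - M / q ^ (k + i)) = (1 - M / X) * (1 - M / (q * X))"
      by (simp_all add: X_def numeral_2_eq_2)
    \<comment> \<open>In terms of \<open>v\<close> and \<open>w\<close> the identity is polynomial,
      to be checked modulo \<open>v * w = 1\<close>.\<close>
    define v w where "v = q / M" and "w = M / q"
    have vw: "v * w = 1" using q_nz M by (simp add: v_def w_def)
    have "X * (1 - M / X) = X - M" "X\<^sup>2 * ((1 - M / X) * (1 - M / (q * X))) = (X - M) * (X - w)"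
      using X q_nz by (simp_all add: w_def power2_eq_square field_simps)
    moreover have "- (\<sigma> * (1 - c * X) * (X - M) * v) - B * (1 - X)
      = B * (M - 1) + (B * (1 + \<rho>) - \<sigma> * v) * (X - M) + B * \<rho> * v * ((X - M) * (X - w))"
    proof -
      have 1: "\<sigma> * (1 - c * X) = \<sigma> - B * \<rho> * X"
        unfolding ec(2)[symmetric] by (simp add: right_diff_distrib)
      have 2: "B * \<rho> * v * ((X - M) * (X - w)) = B * \<rho> * (X - M) * (v * X - 1)"
        unfolding vw[symmetric] by (simp add: right_diff_distrib mult_ac)
      show ?thesis
        unfolding 1 2 by (simp add: algebra_simps)
    qed
    ultimately have "- (\<sigma> * (1 - c * X) * (X * (1 - M / X)) * v) - B * (1 - X)
      = B * (M - 1) + (B * (1 + \<rho>) - \<sigma> * v) * (X * (1 - M / X))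
      + B * \<rho> * v * (X\<^sup>2 * ((1 - M / X) * (1 - M / (q * X))))"
      by (simp only:)
    moreover have "U k - V k = (- (\<sigma> * (1 - c * X) * (X * (1 - M / X)) * v) - B * (1 - X)) * F"
      by (simp add: U_def V_def X_def[symmetric] F_def[symmetric] v_def left_diff_distrib[of _ _ F])
    moreover have "(s + t * (x * y) + u * (z * v)) * F = s * F + t * (F * x * y) + u * (F * z * v)"
      for s t u v x y z
      by (simp add: algebra_simps)
    ultimately show ?thesis
      unfolding p X_def[symmetric] F_def[symmetric] v_def by (simp only: times_divide_eq_right)
  qed
  ultimately show ?thesis
    unfolding M_def[symmetric] by (simp only: sum.distrib sum_distrib_left[symmetric])
qed

text \<open>Powers of \<open>1 / x\<close> are eigenfunctions of the \<open>q\<close>-shift, so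
  there is no lower band entry. The diagonal entry is a multiple of \<open>q ^ n - 1\<close>: at
  \<open>n = 0\<close> the factor \<open>qpow lq (- \<mu>) = A\<close> of \<open>g(x / q)\<close>
  cancels the coefficient \<open>A\<close> of \<open>x\<^sup>2\<close>, which settles column
  0.\<close>

lemma formal_solution_in_confl_op_inverse_powers:
  assumes nz: "P \<noteq> 0" "Q \<noteq> 0" "R \<noteq> 0" "A \<noteq> 0" "L \<noteq> 0"
    and \<mu>: "qpow lq \<mu> = 1 / A" "qpow lq (- \<mu>) = A"
  shows "formal_solution_in (\<lambda>x. 1 / x) 2 lq q (confl_op q P Q R A L) \<mu>
    (\<lambda>n. (P / (L * A)) ^ n * qpoch (L * A) q n
      * (\<Sum>k\<le>n. qpoch (L * A * Q / R) q k / qpoch q q k * q ^ (Suc k choose 2)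
          * (- (R / (P * (L * A)))) ^ k / (q ^ k) ^ n / qpoch q q (n - k)))
    (\<lambda>n x. (1 / x) ^ n)"
proof -
  define \<rho> \<sigma> B K where "\<rho> = Q / P" and "\<sigma> = R / P" and "B = L * A" and "K = 1 / (L\<^sup>2 * A)"
  have B: "B \<noteq> 0" using nz by (simp add: B_def)
  define c e where "c = B * Q / R" and "e = - (R / (P * B))"
  define g where "g k = qpoch c q k / qpoch q q k * q ^ (Suc k choose 2) * e ^ k" for k
  define S where "S n = (\<Sum>k\<le>n. g k / (q ^ k) ^ n / qpoch q q (n - k))" for n
  have ec: "B * e = - \<sigma>" "\<sigma> * c = B * \<rho>"
    using nz B by (simp_all add: c_def e_def \<sigma>_def \<rho>_def)
  note rec = inverse_power_sum_recurrence[OF ec, folded g_def]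
  have S1: "(\<Sum>k\<le>Suc n. g k / (q ^ k) ^ Suc n / qpoch q q (Suc n - k) * q ^ k
      * (\<Prod>i<1. 1 - q ^ Suc n / q ^ (k + i))) = S n" for n
    using qconv_shift[of "\<lambda>k. g k / (q ^ k) ^ n" "Suc n" 1] q_nz
    by (simp add: S_def mult_ac)
  have S2: "(\<Sum>k\<le>n. g k / (q ^ k) ^ n / qpoch q q (n - k) * (q ^ k)\<^sup>2
      * (\<Prod>i<2. 1 - q ^ n / q ^ (k + i))) = (if 2 \<le> n then S (n - 2) else 0)" for n
  proof -
    have "g k / (q ^ k) ^ n / qpoch q q (n - k) * (q ^ k)\<^sup>2
      = g k / (q ^ k) ^ n * (q ^ k)\<^sup>2 / qpoch q q (n - k)" for k
      by simp
    moreover have "g k / (q ^ k) ^ n * (q ^ k)\<^sup>2 = g k / (q ^ k) ^ (n - 2)" if "2 \<le> n" for k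
      using that q_nz by (simp add: power_diff)
    ultimately show ?thesis
      using qconv_shift[of "\<lambda>k. g k / (q ^ k) ^ n * (q ^ k)\<^sup>2" n 2] by (simp add: S_def)
  qed
  have rec': "B * (q ^ Suc n - 1) * S (Suc n) + (B * (1 + \<rho>) - \<sigma> * q / q ^ Suc n) * S n
      + B * \<rho> * q / q ^ Suc n * (if 2 \<le> Suc n then S (Suc n - 2) else 0) = 0" for n
    using rec[of "Suc n"] unfolding S1 S2 S_def[symmetric] .
  define a where "a n = (P / B) ^ n * qpoch B q n * S n" for n
  have "formal_solution_in (\<lambda>x. 1 / x) 2 lq q (confl_op q P Q R A L) \<mu> a (\<lambda>n x. (1 / x) ^ n)"
  proof (rule formal_solution_in_bandI[where b = "\<lambda>n. 0"
        and p = "\<lambda>n. K * B\<^sup>2 * (q ^ n - 1)"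
        and r = "\<lambda>n. K * P * ((1 - B * q ^ n) * (B * (1 + \<rho>) - \<sigma> / q ^ n))"
        and s = "\<lambda>n. K * P\<^sup>2 * ((1 - B * q ^ n) * (1 - B * (q * q ^ n)) * (\<rho> / (q * q ^ n)))"])
    show "poly_basis (\<lambda>x. 1 / x) (\<lambda>n x. (1 / x) ^ n :: complex)"
      by (rule poly_basis_monomials)
  next
    fix n and x :: complex
    assume x: "x \<noteq> 0"
    define y Z where "y = 1 / x" and "Z = q ^ n"
    define F where "F = y ^ n"
    have y: "y \<noteq> 0" "x = 1 / y" "Z \<noteq> 0" using x q_nz by (simp_all add: y_def Z_def)
    have args: "(1 / (q * x)) ^ n = y ^ n / Z" "(1 / (x / q)) ^ n = Z * y ^ n" "(1 / x) ^ n = y ^ n"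
      "(1 / x) ^ (n + 1) = y ^ n * y" "(1 / x) ^ (n + 2) = y ^ n * y\<^sup>2"
      by (simp_all add: y_def Z_def power_mult_distrib power_divide power2_eq_square)
    show "confl_op q P Q R A L x (qpow lq \<mu> * (1 / (q * x)) ^ n)
        (qpow lq (- \<mu>) * (1 / (x / q)) ^ n) ((1 / x) ^ n) / x\<^sup>2
      = 0 * (1 / x) ^ (n - 1) + K * B\<^sup>2 * (q ^ n - 1) * (1 / x) ^ n
      + K * P * ((1 - B * q ^ n) * (B * (1 + \<rho>) - \<sigma> / q ^ n)) * (1 / x) ^ (n + 1)
      + K * P\<^sup>2 * ((1 - B * q ^ n) * (1 - B * (q * q ^ n)) * (\<rho> / (q * q ^ n))) * (1 / x) ^ (n + 2)"
      unfolding args Z_def[symmetric] \<mu> confl_op_def unfolding y(2) K_def B_def \<rho>_def \<sigma>_def F_def[symmetric]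
      using y(1,3) nz q_nz by (simp add: field_simps power2_eq_square)
  next
    show "a 1 * 0 + a 0 * (K * B\<^sup>2 * (q ^ 0 - 1)) = 0" by simp
  next
    have "B * (q - 1) * S 1 + (B * (1 + \<rho>) - \<sigma>) * S 0 = 0"
      using rec'[of 0] q_nz by simp
    then have "K * P * (1 - B) * (B * (q - 1) * S 1 + (B * (1 + \<rho>) - \<sigma>) * S 0) = 0"
      by simp
    then show "a 2 * 0 + a 1 * (K * B\<^sup>2 * (q ^ 1 - 1))
        + a 0 * (K * P * ((1 - B * q ^ 0) * (B * (1 + \<rho>) - \<sigma> / q ^ 0))) = 0"
      using B by (simp add: a_def qpoch_Suc distrib_left power2_eq_square mult_ac)
  next
    fix m
    define Z where "Z = q ^ m"
    have Z: "q ^ (m + 2) = q\<^sup>2 * Z" "q ^ (m + 1) = q * Z" "Z \<noteq> 0"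
      using q_nz by (simp_all add: Z_def power_add power2_eq_square)
    \<comment> \<open>Again \<open>qpoch B q (m + 2)\<close> is the common factor, completed by the
      factors in the band entries.\<close>
    define C where "C = (P / B) ^ m * qpoch B q m * (1 - B * Z) * (1 - B * (q * Z))"
    have a: "a (m + 2) = C * (P / B)\<^sup>2 * S (m + 2)"
      "a (m + 1) * (1 - B * (q * Z)) = C * (P / B) * S (m + 1)"
      "a m * ((1 - B * Z) * (1 - B * (q * Z))) = C * S m"
      unfolding a_def C_def Z_def
      by (simp_all add: qpoch_Suc power2_eq_square mult_ac)
    have "B * (q\<^sup>2 * Z - 1) * S (m + 2) + (B * (1 + \<rho>) - \<sigma> / (q * Z)) * S (m + 1)
        + B * \<rho> / (q * Z) * S m = 0"
    proof -
      have "\<sigma> * q / (q\<^sup>2 * Z) = \<sigma> / (q * Z)" "B * \<rho> * q / (q\<^sup>2 * Z) = B * \<rho> / (q * Z)"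
        using q_nz by (simp_all add: power2_eq_square)
      then show ?thesis
        using rec'[of "m + 1"] unfolding Suc_eq_plus1 add.assoc one_add_one Z by simp
    qed
    then have "K * C * (P\<^sup>2 / B) * (B * (q\<^sup>2 * Z - 1) * S (m + 2)
        + (B * (1 + \<rho>) - \<sigma> / (q * Z)) * S (m + 1) + B * \<rho> / (q * Z) * S m) = 0"
      by (simp only: mult_zero_right)
    moreover have "a (m + 2) * (K * B\<^sup>2 * (q\<^sup>2 * Z - 1))
        + a (m + 1) * (1 - B * (q * Z)) * (K * P * (B * (1 + \<rho>) - \<sigma> / (q * Z)))
        + a m * ((1 - B * Z) * (1 - B * (q * Z))) * (K * P\<^sup>2 * (\<rho> / (q * Z)))
      = K * C * (P\<^sup>2 / B) * (B * (q\<^sup>2 * Z - 1) * S (m + 2)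
        + (B * (1 + \<rho>) - \<sigma> / (q * Z)) * S (m + 1) + B * \<rho> / (q * Z) * S m)"
      unfolding a using B by (simp add: distrib_left power2_eq_square mult_ac)
    ultimately show "a (m + 3) * 0 + a (m + 2) * (K * B\<^sup>2 * (q ^ (m + 2) - 1))
        + a (m + 1) * (K * P * ((1 - B * q ^ (m + 1)) * (B * (1 + \<rho>) - \<sigma> / q ^ (m + 1))))
        + a m * (K * P\<^sup>2 * ((1 - B * q ^ m) * (1 - B * (q * q ^ m)) * (\<rho> / (q * q ^ m)))) = 0"
      unfolding Z Z_def[symmetric] by (simp only: mult_ac mult_zero_left mult_zero_right add_0_left)
  qed simp
  then show ?thesis
    unfolding a_def S_def g_def c_def e_def B_def .
qed

end

section \<open>Complex powers of \<open>q\<close> and the return to the original parameters\<close>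

lemma qpow_nz [simp]: "qpow lq a \<noteq> 0"
  by (simp add: qpow_def)

lemma qpow_add: "qpow lq (a + b) = qpow lq a * qpow lq b"
  by (simp add: qpow_def exp_add distrib_right)

lemma qpow_minus: "qpow lq (- a) = 1 / qpow lq a"
  by (simp add: qpow_def exp_minus inverse_eq_divide)

lemma qpow_diff: "qpow lq (a - b) = qpow lq a / qpow lq b"
  by (simp add: qpow_def exp_diff left_diff_distrib)

lemma qpow_of_nat: "exp lq = q \<Longrightarrow> qpow lq (of_nat n) = q ^ n"
  by (simp add: qpow_def exp_of_nat_mult)

lemma qpow_half: "exp lq = q \<Longrightarrow> qpow lq (1 / 2) * qpow lq (1 / 2) = q"
  by (simp add: qpow_def flip: exp_add)

lemma qpow_one: "exp lq = q \<Longrightarrow> qpow lq 1 = q"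
  by (simp add: qpow_def)

lemma sc_variant_lhs_eq_confl_op:
  fixes lq q h1 h2 l1 \<alpha>1 lam t1 t2
  assumes "exp lq = q"
  shows "sc_variant_lhs lq q h1 h2 l1 \<alpha>1 lam t1 t2
    = confl_op q (qpow lq (h1 + 1/2) * t1) (qpow lq (h2 + 1/2) * t2)
        (qpow lq (h1 + h2 - l1 + 1/2) * t2) (qpow lq \<alpha>1) (qpow lq lam)"
proof -
  define H1 H2 L1 L r where "H1 = qpow lq h1" and "H2 = qpow lq h2" and "L1 = qpow lq l1"
    and "L = qpow lq lam" and "r = qpow lq (1 / 2)"
  have nz: "H1 \<noteq> 0" "H2 \<noteq> 0" "L1 \<noteq> 0" "L \<noteq> 0" "r \<noteq> 0"
    by (simp_all add: H1_def H2_def L1_def L_def r_def)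
  \<comment> \<open>Half-integral exponents enter through \<open>r\<close> alone, so with
    \<open>q = r * r\<close> the coefficients can be compared as rational expressions.\<close>
  have q: "q = r * r" using qpow_half[OF assms] by (simp add: r_def)
  have 2: "qpow lq (2 * lam) = L * L" unfolding L_def mult_2 qpow_add by (rule refl)
  note exps = qpow_add qpow_diff qpow_minus 2
    H1_def[symmetric] H2_def[symmetric] L1_def[symmetric] L_def[symmetric] r_def[symmetric]
  have gp: "qpow lq (h1 + h2 - l1 - 2 * lam + 1/2) * t2 * (qpow lq (l1 - 1/2) * t1 - x)
      = (qpow lq (h1 + 1/2) * t1 * (qpow lq (h2 + 1/2) * t2) / q
          - qpow lq (h1 + h2 - l1 + 1/2) * t2 * x) / (qpow lq lam)\<^sup>2" for x
    unfolding exps q using nz by (simp add: right_diff_distrib diff_divide_distrib power2_eq_square mult_ac)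
  have lin: "qpow lq (h1 + h2 - lam + 1/2)
        * (qpow lq (- h2) * t1 + qpow lq (- h1) * t2 + qpow lq (- l1) * t2)
      = (qpow lq (h1 + 1/2) * t1 + qpow lq (h2 + 1/2) * t2 + qpow lq (h1 + h2 - l1 + 1/2) * t2)
        / qpow lq lam"
    unfolding exps using nz by (simp add: field_simps)
  have const: "qpow lq (h1 + h2 - lam) * (q + 1) * t1 * t2
      = qpow lq (h1 + 1/2) * t1 * (qpow lq (h2 + 1/2) * t2) * (q + 1) / (q * qpow lq lam)"
    unfolding exps q using nz by simp
  show ?thesis
    unfolding fun_eq_iff sc_variant_lhs_def confl_op_def gp lin const by blast
qed

theorem theorem3p1:
  fixes q lq h1 h2 l1 \<alpha>1 lam t1 t2 :: complex
  assumes "q \<noteq> 0" and "exp lq = q" and "\<And>n::nat. n > 0 \<Longrightarrow> q ^ n \<noteq> 1"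
    and "t1 \<noteq> 0" and "t2 \<noteq> 0"
  shows
    "formal_solution lq q (sc_variant_lhs lq q h1 h2 l1 \<alpha>1 lam t1 t2) (- \<alpha>1)
       (\<lambda>n. (qpow lq (- lam - \<alpha>1 + h1 + 1/2) * t1) ^ n * qpoch (qpow lq (lam + \<alpha>1)) q n
          * (\<Sum>l\<le>n. qpoch (qpow lq (lam + \<alpha>1 - h1 + l1)) q l / (qpoch q q (n - l) * qpoch q q l)
               * qpow lq (- (of_nat l * (2 * of_nat n - of_nat l - 1) / 2))
               * (- qpow lq (- lam - \<alpha>1 - l1 + h2) * t2 / t1) ^ l))
       (\<lambda>n x. (1 / x) ^ n)
     \<and>
     ((\<forall>n. qpoch (qpow lq (h1 - l1 + 1)) q n \<noteq> 0) \<longrightarrow>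
      (\<forall>n. qpoch (qpow lq (h2 - l1 + 1) * t2 / t1) q n \<noteq> 0) \<longrightarrow>
      formal_solution lq q (sc_variant_lhs lq q h1 h2 l1 \<alpha>1 lam t1 t2) lam
       (\<lambda>n. q ^ n * (qpoch (qpow lq (lam + \<alpha>1)) q n
          / (qpoch (qpow lq (h1 - l1 + 1)) q n * qpoch (qpow lq (h2 - l1 + 1) * t2 / t1) q n
             * qpoch q q n)))
       (\<lambda>n x. qpoch (x / (qpow lq (l1 - 1/2) * t1)) q n)
      \<and> (\<forall>n x. q ^ n * (qpoch (qpow lq (lam + \<alpha>1)) q n
            / (qpoch (qpow lq (h1 - l1 + 1)) q n * qpoch (qpow lq (h2 - l1 + 1) * t2 / t1) q n
               * qpoch q q n)) * qpoch (x / (qpow lq (l1 - 1/2) * t1)) q n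
          = bhyp_term [qpow lq (lam + \<alpha>1), 0, x / (qpow lq (l1 - 1/2) * t1)]
              [qpow lq (h1 - l1 + 1), qpow lq (h2 - l1 + 1) * t2 / t1] q q n))
     \<and>
     ((\<forall>n. qpoch (qpow lq (h1 - l1 + 1)) q n \<noteq> 0) \<longrightarrow>
      formal_solution lq q (sc_variant_lhs lq q h1 h2 l1 \<alpha>1 lam t1 t2) (- \<alpha>1)
       (\<lambda>n. qpoch (qpow lq (lam + \<alpha>1)) q n * q ^ n
          * (\<Sum>k\<le>n. q ^ (k\<^sup>2) * (qpow lq (lam + \<alpha>1 + h1 - h2) * t1 / t2) ^ k
               / (qpoch (qpow lq (h1 - l1 + 1)) q k * qpoch q q k * qpoch q q (n - k))))
       (\<lambda>n x. qpoch (qpow lq (h1 + 1/2) * t1 / x) q n))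
     \<and>
     ((\<forall>n. qpoch (qpow lq (h2 - l1 + 1) * t2 / t1) q n \<noteq> 0) \<longrightarrow>
      formal_solution lq q (sc_variant_lhs lq q h1 h2 l1 \<alpha>1 lam t1 t2) (- \<alpha>1)
       (\<lambda>n. q ^ n * qpoch (qpow lq (lam + \<alpha>1)) q n
          / qpoch (qpow lq (h2 - l1 + 1) * t2 / t1) q n
          * (\<Sum>k\<le>n. qpoch (qpow lq (lam - h1 + l1 + \<alpha>1)) q k / (qpoch q q k * qpoch q q (n - k))
               * q ^ (k * (k + 1) div 2) * (- qpow lq (h2 - l1) * t2 / t1) ^ k))
       (\<lambda>n x. qpoch (qpow lq (h2 + 1/2) * t2 / x) q n))"
proof -
  interpret non_root_of_unity q
    using assms(1,3) by unfold_locales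
  define P Q R A L where "P = qpow lq (h1 + 1/2) * t1" and "Q = qpow lq (h2 + 1/2) * t2"
    and "R = qpow lq (h1 + h2 - l1 + 1/2) * t2" and "A = qpow lq \<alpha>1" and "L = qpow lq lam"
  have nz: "P \<noteq> 0" "Q \<noteq> 0" "R \<noteq> 0" "A \<noteq> 0" "L \<noteq> 0"
    using assms by (simp_all add: P_def Q_def R_def A_def L_def)
  have lhs: "sc_variant_lhs lq q h1 h2 l1 \<alpha>1 lam t1 t2 = confl_op q P Q R A L"
    unfolding P_def Q_def R_def A_def L_def by (rule sc_variant_lhs_eq_confl_op[OF assms(2)])
  have \<mu>: "qpow lq (- \<alpha>1) = 1 / A" "qpow lq (- (- \<alpha>1)) = A" "qpow lq lam = L" "qpow lq (- lam) = 1 / L"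
    by (simp_all add: A_def L_def qpow_minus)
  note qp = qpow_add qpow_diff qpow_minus qpow_one[OF assms(2)]
  note half = qpow_half[OF assms(2)]
  have par: "qpow lq (lam + \<alpha>1) = L * A"
    "qpow lq (h1 - l1 + 1) = q * R / Q"
    "qpow lq (h2 - l1 + 1) * t2 / t1 = q * R / P"
    "qpow lq (lam + \<alpha>1 + h1 - h2) * t1 / t2 = L * A * P / Q"
    "qpow lq (lam - h1 + l1 + \<alpha>1) = L * A * Q / R"
    "qpow lq (lam + \<alpha>1 - h1 + l1) = L * A * Q / R"
    "- qpow lq (h2 - l1) * t2 / t1 = - (R / P)"
    "qpow lq (- lam - \<alpha>1 + h1 + 1/2) * t1 = P / (L * A)"
    "- qpow lq (- lam - \<alpha>1 - l1 + h2) * t2 / t1 = - (R / (P * (L * A)))"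
    unfolding P_def Q_def R_def A_def L_def qp using assms(4,5) by (simp_all add: field_simps)
  have arg: "x / (qpow lq (l1 - 1/2) * t1) = q * R / (P * Q) * x" for x
    unfolding P_def Q_def R_def qp half[symmetric] using assms(4,5) by (simp add: field_simps)
  \<comment> \<open>The exponent \<open>- l (2 n - l - 1) / 2\<close> equals
    \<open>l (l + 1) / 2 - l n\<close>, an integer; the complex power is therefore a quotient of
    natural powers of \<open>q\<close>.\<close>
  have i: "qpoch c q l / (qpoch q q (n - l) * qpoch q q l)
      * qpow lq (- (of_nat l * (2 * of_nat n - of_nat l - 1) / 2)) * e ^ l
      = qpoch c q l / qpoch q q l * q ^ (Suc l choose 2) * e ^ l / (q ^ l) ^ n / qpoch q q (n - l)"
    for c e n l
  proof -
    have "(of_nat l * (of_nat l + 1) / 2 :: complex) = of_nat (Suc l choose 2)"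
      by (induction l) (simp_all add: numeral_2_eq_2 field_simps)
    then have "- (of_nat l * (2 * of_nat n - of_nat l - 1) / 2 :: complex)
        = of_nat (Suc l choose 2) - of_nat (l * n)"
      by (simp add: field_simps)
    then have "qpow lq (- (of_nat l * (2 * of_nat n - of_nat l - 1) / 2))
        = q ^ (Suc l choose 2) / (q ^ l) ^ n"
      by (simp only: qpow_diff qpow_of_nat[OF assms(2)] power_mult)
    then show ?thesis by simp
  qed
  have iv: "q ^ n * qpoch (L * A) q n / qpoch (q * R / P) q n
      * (\<Sum>k\<le>n. qpoch (L * A * Q / R) q k / (qpoch q q k * qpoch q q (n - k))
          * q ^ (k * (k + 1) div 2) * (- (R / P)) ^ k)
      = qpoch (L * A) q n * q ^ n * (\<Sum>k\<le>n. q ^ (k\<^sup>2) * (L * A * Q / P) ^ k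
      / (qpoch (q * R / P) q k * qpoch q q k * qpoch q q (n - k)))"
    if b: "\<And>n. qpoch (q * R / P) q n \<noteq> 0" for n
  proof -
    \<comment> \<open>This is the shape \<open>c * b / q\<close> required by
      \<open>sum_transform\<close>, with \<open>b\<close> the lower parameter of (iv) and
      \<open>c\<close> the upper parameter of its inner sum.\<close>
    have c: "L * A * Q / P = (L * A * Q / R) * (q * R / P) / q"
      using nz assms(1) by simp
    have tri: "x * q ^ (k * (k + 1) div 2) * (- (R / P)) ^ k = x * q ^ (k choose 2) * (- (q * R / P)) ^ k"
      for x k
    proof -
      \<comment> \<open>The surplus \<open>q ^ k\<close> over \<open>q ^ (k choose 2)\<close> turns
        \<open>R / P\<close> into the lower parameter \<open>q * R / P\<close>.\<close>
      have "k * (k + 1) div 2 = Suc k choose 2" by (simp add: choose_two)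
      also have "\<dots> = (k choose 2) + k" by (simp add: numeral_2_eq_2)
      finally have "q ^ (k * (k + 1) div 2) = q ^ (k choose 2) * q ^ k" by (simp add: power_add)
      moreover have "(- (q * R / P)) ^ k = q ^ k * (- (R / P)) ^ k"
        unfolding power_mult_distrib[symmetric] by simp
      ultimately show ?thesis by (simp only: mult.assoc)
    qed
    show ?thesis
      unfolding c tri sum_transform[OF b] by (simp only: times_divide_eq_right times_divide_eq_left mult_ac)
  qed
  show ?thesis
    unfolding lhs par arg i
  proof (intro conjI impI allI)
    show "formal_solution lq q (confl_op q P Q R A L) (- \<alpha>1)
       (\<lambda>n. (P / (L * A)) ^ n * qpoch (L * A) q n
      * (\<Sum>k\<le>n. qpoch (L * A * Q / R) q k / qpoch q q k * q ^ (Suc k choose 2)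
          * (- (R / (P * (L * A)))) ^ k / (q ^ k) ^ n / qpoch q q (n - k)))
       (\<lambda>n x. (1 / x) ^ n)"
      unfolding formal_solution_def
      using formal_solution_in_confl_op_inverse_powers[OF nz \<mu>(1,2)] by (rule disjI2)
  next
    assume "\<forall>n. qpoch (q * R / Q) q n \<noteq> 0" "\<forall>n. qpoch (q * R / P) q n \<noteq> 0"
    then show "formal_solution lq q (confl_op q P Q R A L) lam
       (\<lambda>n. q ^ n * (qpoch (L * A) q n / (qpoch (q * R / Q) q n * qpoch (q * R / P) q n * qpoch q q n)))
       (\<lambda>n x. qpoch (q * R / (P * Q) * x) q n)"
      unfolding formal_solution_def
      using formal_solution_in_confl_op_qpoch[OF nz \<mu>(3,4)] by blast
  next
    fix n x
    \<comment> \<open>With three upper and two lower parameters the power \<open>1 + s - r\<close>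
      is 0, and the upper parameter 0 contributes the factor 1.\<close>
    show "q ^ n * (qpoch (L * A) q n / (qpoch (q * R / Q) q n * qpoch (q * R / P) q n * qpoch q q n))
        * qpoch (q * R / (P * Q) * x) q n
      = bhyp_term [L * A, 0, q * R / (P * Q) * x] [q * R / Q, q * R / P] q q n"
      by (simp add: bhyp_term_def mult_ac)
  next
    assume "\<forall>n. qpoch (q * R / Q) q n \<noteq> 0"
    then show "formal_solution lq q (confl_op q P Q R A L) (- \<alpha>1)
       (\<lambda>n. qpoch (L * A) q n * q ^ n * (\<Sum>k\<le>n. q ^ (k\<^sup>2) * (L * A * P / Q) ^ k
          / (qpoch (q * R / Q) q k * qpoch q q k * qpoch q q (n - k))))
       (\<lambda>n x. qpoch (qpow lq (h1 + 1/2) * t1 / x) q n)"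
      unfolding formal_solution_def P_def[symmetric]
      using formal_solution_in_confl_op_qpoch_inverse[OF nz(1,2,4,5) \<mu>(1,2)] by blast
  next
    assume "\<forall>n. qpoch (q * R / P) q n \<noteq> 0"
    then have b: "\<And>n. qpoch (q * R / P) q n \<noteq> 0" by blast
    \<comment> \<open>After \<open>iv\<close> the coefficients are those of (iii) with
      \<open>P\<close> and \<open>Q\<close> exchanged, and the operator is symmetric under this
      exchange.\<close>
    show "formal_solution lq q (confl_op q P Q R A L) (- \<alpha>1)
       (\<lambda>n. q ^ n * qpoch (L * A) q n / qpoch (q * R / P) q n
          * (\<Sum>k\<le>n. qpoch (L * A * Q / R) q k / (qpoch q q k * qpoch q q (n - k))
               * q ^ (k * (k + 1) div 2) * (- (R / P)) ^ k))
       (\<lambda>n x. qpoch (qpow lq (h2 + 1/2) * t2 / x) q n)"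
      unfolding formal_solution_def Q_def[symmetric] iv[OF b]
      unfolding confl_op_commute[of q P]
      using formal_solution_in_confl_op_qpoch_inverse[OF nz(2,1,4,5) \<mu>(1,2) b] by (rule disjI2)
  qed
qed

end
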